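(* For any increasing sequence of finite domains $(\mathcal D_n)_{n\ge0}$ with $\bigcup_n\mathcal D_n=\mathbb H$, the measures $\nu^{+,\mathrm{free}}_{\mathcal D_n}$ converge (in the sense that the probability of every event depending on finitely many faces converges) to a measure $\nu^{+,\mathrm{free}}_{\mathbb H}$ on $\{+,-\}^{F(\mathbb H)}$. Moreover $\nu^{+,\mathrm{free}}_{\mathbb H}$ is translation-invariant, ergodic with respect to translations, and positively associated.
   Context: $\mathbb H$ is the hexagonal lattice; $F(\mathbb H)$ its set of faces. A domain is a subgraph $\mathcal D$ of $\mathbb H$ without isolated vertices for which there exists a self-avoiding polygon $\partial_E\mathcal D$ such that $E(\mathcal D)$ is the set of edges in the bounded component of $\mathbb H\setminus\partial_E\mathcal D$; $F(\mathcal D)$ is the set of faces adjacent to an edge of $\mathcal D$ and $\partial_{\mathrm{in}}\mathcal D$ the faces of $F(\mathcal D)$ bounded by an edge of $\partial_E\mathcal D$. A pair $(\sigma_r,\sigma_b)\in\{+,-\}^{F(\mathcal D)}\times\{+,-\}^{F(\mathcal D)}$ is coherent if for all adjacent faces $u,v$, $\sigma_r(u)=\sigma_r(v)$ or $\sigma_b(u)=\sigma_b(v)$; $\mu_{\mathcal D}$ is uniform on coherent pairs, and $\nu^{+,\mathrm{free}}_{\mathcal D}$ is the law of $\sigma_r$ under $\mu_{\mathcal D}(\cdot\mid\sigma_r\equiv+\text{ on }\partial_{\mathrm{in}}\mathcal D)$. Positive association means $\nu(A\cap B)\ge\nu(A)\nu(B)$ for increasing events $A,B$, with pointwise order and $-\le+$.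 *)

theory Defs
  imports "HOL-Probability.Probability"
begin

text \<open>Faces of H are indexed by the triangular lattice Z x Z: the face (a,b) is the
hexagon centred at a + b*w, where w = exp(i pi/3).  Vertices of H are the triangles
of the triangular lattice: (a,b,True) is the up-triangle with corners (a,b),(a+1,b),(a,b+1),
(a,b,False) is the down-triangle with corners (a+1,b),(a,b+1),(a+1,b+1).
A vertex of H is placed at the centroid of its triangle.\<close>

type_synonym face = "int \<times> int"
type_synonym hvertex = "int \<times> int \<times> bool"
type_synonym hedge = "hvertex set"

definition omega :: complex where
  "omega = cis (pi / 3)"

definition face_centre :: "face \<Rightarrow> complex" where
  "face_centre f = of_int (fst f) + of_int (snd f) * omega"

definition hpos :: "hvertex \<Rightarrow> complex" where
  "hpos v = (case v of (a, b, up) \<Rightarrow>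
      face_centre (a, b) + (if up then 1 else 2) * (1 + omega) / 3)"

definition corners :: "hvertex \<Rightarrow> face set" where
  "corners v = (case v of (a, b, up) \<Rightarrow>
      (if up then {(a, b), (a + 1, b), (a, b + 1)}
             else {(a + 1, b), (a, b + 1), (a + 1, b + 1)}))"

definition hex_edges :: "hedge set" where
  "hex_edges = (\<Union>a b. {{(a, b, True), (a, b, False)},
                          {(a, b, True), (a, b - 1, False)},
                          {(a, b, True), (a - 1, b, False)}})"

definition face_borders :: "face \<Rightarrow> hedge \<Rightarrow> bool" where
  "face_borders f e \<longleftrightarrow> e \<in> hex_edges \<and> (\<forall>v\<in>e. f \<in> corners v)"

definition face_adj :: "face \<Rightarrow> face \<Rightarrow> bool" where
  "face_adj f g \<longleftrightarrow> f \<noteq> g \<and> (\<exists>e\<in>hex_edges. face_borders f e \<and> face_borders g e)"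

definition edge_pts :: "hedge \<Rightarrow> complex set" where
  "edge_pts e = (\<Union>{closed_segment (hpos u) (hpos v) | u v. e = {u, v}})"

definition edge_open_pts :: "hedge \<Rightarrow> complex set" where
  "edge_open_pts e = (\<Union>{open_segment (hpos u) (hpos v) | u v. e = {u, v}})"

definition is_sap :: "hedge set \<Rightarrow> bool" where
  "is_sap P \<longleftrightarrow> (\<exists>vs :: hvertex list. distinct vs \<and> length vs \<ge> 3 \<and>
      (\<forall>i < length vs. {vs ! i, vs ! ((i + 1) mod length vs)} \<in> hex_edges) \<and>
      P = {{vs ! i, vs ! ((i + 1) mod length vs)} | i. i < length vs})"

text \<open>E(D) for the domain D with boundary polygon P: the edges of H lying in the
bounded component of the plane minus the polygon.\<close>
definition dom_edges :: "hedge set \<Rightarrow> hedge set" where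
  "dom_edges P = {e \<in> hex_edges. e \<notin> P \<and>
      (\<exists>C \<in> components (- (\<Union>(edge_pts ` P))). bounded C \<and> edge_open_pts e \<subseteq> C)}"

definition dom_faces :: "hedge set \<Rightarrow> face set" where
  "dom_faces P = {f. \<exists>e \<in> dom_edges P. face_borders f e}"

definition dom_inner_boundary :: "hedge set \<Rightarrow> face set" where
  "dom_inner_boundary P = {f \<in> dom_faces P. \<exists>e \<in> P. face_borders f e}"

text \<open>Spins: True = +, False = -.  A configuration on F(D) is encoded as a function on all
faces which is + outside F(D).\<close>
definition cfgs :: "face set \<Rightarrow> (face \<Rightarrow> bool) set" where
  "cfgs F = {\<sigma>. \<forall>f. f \<notin> F \<longrightarrow> \<sigma> f = True}"

definition coherent :: "face set \<Rightarrow> (face \<Rightarrow> bool) \<Rightarrow> (face \<Rightarrow> bool) \<Rightarrow> bool" where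
  "coherent F \<sigma>r \<sigma>b \<longleftrightarrow> (\<forall>u\<in>F. \<forall>v\<in>F. face_adj u v \<longrightarrow> \<sigma>r u = \<sigma>r v \<or> \<sigma>b u = \<sigma>b v)"

definition plus_free_pairs :: "hedge set \<Rightarrow> ((face \<Rightarrow> bool) \<times> (face \<Rightarrow> bool)) set" where
  "plus_free_pairs P = {(\<sigma>r, \<sigma>b). \<sigma>r \<in> cfgs (dom_faces P) \<and> \<sigma>b \<in> cfgs (dom_faces P) \<and>
      coherent (dom_faces P) \<sigma>r \<sigma>b \<and> (\<forall>f \<in> dom_inner_boundary P. \<sigma>r f = True)}"

definition nu_plus_free :: "hedge set \<Rightarrow> (face \<Rightarrow> bool) set \<Rightarrow> real" where
  "nu_plus_free P A = real (card {p \<in> plus_free_pairs P. fst p \<in> A}) / real (card (plus_free_pairs P))"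

definition cfg_space :: "(face \<Rightarrow> bool) measure" where
  "cfg_space = PiM UNIV (\<lambda>_. count_space UNIV)"

definition cylinder_event :: "(face \<Rightarrow> bool) set \<Rightarrow> bool" where
  "cylinder_event A \<longleftrightarrow> (\<exists>S. finite S \<and>
      (\<forall>\<omega> \<omega>'. (\<forall>x\<in>S. \<omega> x = \<omega>' x) \<longrightarrow> (\<omega> \<in> A \<longleftrightarrow> \<omega>' \<in> A)))"

text \<open>Translations of H act on faces by shifts of Z x Z.\<close>
definition shift_cfg :: "int \<times> int \<Rightarrow> (face \<Rightarrow> bool) \<Rightarrow> (face \<Rightarrow> bool)" where
  "shift_cfg v \<omega> = (\<lambda>f. \<omega> (fst f + fst v, snd f + snd v))"

definition increasing_event :: "(face \<Rightarrow> bool) set \<Rightarrow> bool" where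
  "increasing_event A \<longleftrightarrow> (\<forall>\<omega> \<omega>'. \<omega> \<in> A \<longrightarrow> \<omega> \<le> \<omega>' \<longrightarrow> \<omega>' \<in> A)"

end

theory Submission
  imports Defs "HOL-Library.Z2" "HOL-Library.Function_Algebras"
begin

text \<open>The key point is the FKG lattice condition for the red marginal, whose weight is the number of blue
  configurations coherent with the given red one. Viewing blue configurations as functions into the
  two-element field modulo constants, their differentials are the closed 1-forms supported on edges
  with equal red spins at both ends. Such a form splits into a form living on plus edges and one living on minus
  edges, so the weight is a product of the sizes of two groups. For each of them,
  \<open>G(X) \<inter> G(Y) = G(X \<inter> Y)\<close> and \<open>G(X) + G(Y) \<subseteq> G(X \<union> Y)\<close>, which gives log-supermodularity.

  Extending by plus outside the domain, the measure depends only on the set of interior faces, and by FKG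
  the probability of an increasing event decreases in this set. Hence the limit exists along the directed set of all
  finite sets of faces, which yields independence of the exhaustion and translation invariance. Comparison with
  two distant translates of a finite set gives mixing, hence ergodicity. Positive association passes from cylinder
  events to measurable increasing events through compact inner approximations and their up-closures.\<close>

section \<open>The four functions theorem\<close>

text \<open>The number of blue configurations coherent with a minus set \<open>M\<close> is 2 to the
  number of classes into which the edges between \<open>M\<close> and its complement glue the faces.
  This number is not monotone in \<open>M\<close>, so no comparison is visible before the splitting;
  afterwards one factor grows with \<open>M\<close> and the other with its complement.
  Complementation exchanges union and intersection, which the product inequality does not notice, so
  both factors point the same way.

  Plus on the inner boundary keeps every neighbour of a minus face inside the domain, so the free
  blue boundary contributes only powers of two, and these cancel in the probabilities. This is the
  main geometric input about polygons. It rests on the three edges at each vertex of H: a polygon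
  through a corner of a face uses at least two of them, and at most one edge there does not border
  the face.\<close>

lemma four_numbers:
  fixes a0 a1 b0 b1 c0 c1 d0 d1 :: real
  assumes nonneg: "0 \<le> a0" "0 \<le> a1" "0 \<le> b0" "0 \<le> b1" "0 \<le> c0" "0 \<le> c1" "0 \<le> d0" "0 \<le> d1"
    and le: "a0 * b0 \<le> c0 * d0" "a0 * b1 \<le> c1 * d0" "a1 * b0 \<le> c1 * d0" "a1 * b1 \<le> c1 * d1"
  shows "(a0 + a1) * (b0 + b1) \<le> (c0 + c1) * (d0 + d1)"
proof -
  let ?p = "a0 * b1" and ?q = "a1 * b0" and ?r = "c1 * d0"
  \<comment> \<open>The hypotheses on \<open>a0 * b0\<close> and \<open>a1 * b1\<close> match two
    terms of the expanded right side, which leaves the cross terms. Bounding each of them by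
    \<open>?r\<close> loses too much; the product \<open>?p * ?q\<close> must be used as well,
    through \<open>(?r - ?p) * (?r - ?q) \<ge> 0\<close>.\<close>
  have "?p + ?q \<le> ?r + c0 * d1"
  proof (cases "?r = 0")
    case True
    then have "?p + ?q \<le> 0" using le by linarith
    moreover have "0 \<le> c0 * d1" using nonneg by simp
    ultimately show ?thesis using True by linarith
  next
    case False
    then have r: "?r > 0" using nonneg by (simp add: less_le)
    have "?p * ?q = (a0 * b0) * (a1 * b1)" by (simp add: algebra_simps)
    also have "\<dots> \<le> (c0 * d0) * (c1 * d1)" using nonneg by (intro mult_mono le) auto
    finally have pq: "?p * ?q \<le> ?r * (c0 * d1)" by (simp add: algebra_simps)
    have "0 \<le> (?r - ?p) * (?r - ?q)" using le by simp
    then have "?r * (?p + ?q) \<le> ?r * ?r + ?p * ?q" by (simp add: algebra_simps)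
    also have "\<dots> \<le> ?r * (?r + c0 * d1)" using pq by (simp add: algebra_simps)
    finally show ?thesis using r mult_le_cancel_left_pos by blast
  qed
  then show ?thesis using le by (simp add: algebra_simps)
qed

lemma sum_Pow_insert:
  fixes f :: "'a set \<Rightarrow> 'b::comm_monoid_add"
  assumes "finite I" "x \<notin> I"
  shows "sum f (Pow (insert x I)) = (\<Sum>S\<in>Pow I. f S + f (insert x S))"
proof -
  have "sum f (Pow (insert x I)) = sum f (Pow I) + sum f (insert x ` Pow I)"
    unfolding Pow_insert using assms by (intro sum.union_disjoint) auto
  also have "sum f (insert x ` Pow I) = (\<Sum>S\<in>Pow I. f (insert x S))"
    using assms by (subst sum.reindex) (auto simp: inj_on_def)
  finally show ?thesis by (simp add: sum.distrib)
qed

text \<open>The Ahlswede-Daykin inequality. Summing out one element \<open>x\<close> leaves four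
  functions on a smaller ground set, and their hypothesis is \<open>four_numbers\<close>, the index
  0 or 1 telling whether \<open>x\<close> is present.\<close>

theorem four_functions:
  fixes \<alpha> \<beta> \<gamma> \<delta> :: "'a set \<Rightarrow> real"
  assumes "finite I"
    and "\<And>S. S \<subseteq> I \<Longrightarrow> 0 \<le> \<alpha> S" "\<And>S. S \<subseteq> I \<Longrightarrow> 0 \<le> \<beta> S"
        "\<And>S. S \<subseteq> I \<Longrightarrow> 0 \<le> \<gamma> S" "\<And>S. S \<subseteq> I \<Longrightarrow> 0 \<le> \<delta> S"
    and "\<And>S T. S \<subseteq> I \<Longrightarrow> T \<subseteq> I \<Longrightarrow> \<alpha> S * \<beta> T \<le> \<gamma> (S \<union> T) * \<delta> (S \<inter> T)"
  shows "sum \<alpha> (Pow I) * sum \<beta> (Pow I) \<le> sum \<gamma> (Pow I) * sum \<delta> (Pow I)"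
  using assms
proof (induction I arbitrary: \<alpha> \<beta> \<gamma> \<delta> rule: finite_induct)
  case empty
  then show ?case by simp
next
  case (insert x I)
  note nonneg = insert.prems(1-4) and le = insert.prems(5)
  have "(\<Sum>S\<in>Pow I. \<alpha> S + \<alpha> (insert x S)) * (\<Sum>S\<in>Pow I. \<beta> S + \<beta> (insert x S))
     \<le> (\<Sum>S\<in>Pow I. \<gamma> S + \<gamma> (insert x S)) * (\<Sum>S\<in>Pow I. \<delta> S + \<delta> (insert x S))"
  proof (rule insert.IH)
    fix S T assume ST: "S \<subseteq> I" "T \<subseteq> I"
    then have x: "x \<notin> S" "x \<notin> T" using insert.hyps by auto
    have sub: "S \<subseteq> insert x I" "T \<subseteq> insert x I" "insert x S \<subseteq> insert x I" "insert x T \<subseteq> insert x I"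
      "S \<union> T \<subseteq> insert x I" "S \<inter> T \<subseteq> insert x I" "insert x (S \<union> T) \<subseteq> insert x I"
      "insert x (S \<inter> T) \<subseteq> insert x I"
      using ST by auto
    have eq: "insert x S \<inter> T = S \<inter> T" "S \<inter> insert x T = S \<inter> T"
      using x by auto
    show "(\<alpha> S + \<alpha> (insert x S)) * (\<beta> T + \<beta> (insert x T))
       \<le> (\<gamma> (S \<union> T) + \<gamma> (insert x (S \<union> T))) * (\<delta> (S \<inter> T) + \<delta> (insert x (S \<inter> T)))"
      using le[OF sub(1,2)] le[OF sub(1,4)] le[OF sub(3,2)] le[OF sub(3,4)] eq sub
      by (intro four_numbers nonneg) auto
  next
    fix S assume S: "S \<subseteq> I"
    then have sub: "S \<subseteq> insert x I" "insert x S \<subseteq> insert x I" by auto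
    show "0 \<le> \<alpha> S + \<alpha> (insert x S)" "0 \<le> \<beta> S + \<beta> (insert x S)"
      "0 \<le> \<gamma> S + \<gamma> (insert x S)" "0 \<le> \<delta> S + \<delta> (insert x S)"
      using nonneg(1)[OF sub(1)] nonneg(1)[OF sub(2)] nonneg(2)[OF sub(1)] nonneg(2)[OF sub(2)]
        nonneg(3)[OF sub(1)] nonneg(3)[OF sub(2)] nonneg(4)[OF sub(1)] nonneg(4)[OF sub(2)]
      by simp_all
  qed
  then show ?case using insert.hyps by (simp add: sum_Pow_insert)
qed

text \<open>Down-sets, because configurations will be encoded by their minus faces. For S in
  \<open>A\<close> and T in \<open>B\<close> the intersection lies in both, so the indicator of
  \<open>A \<inter> B\<close> can be attached to the intersection factor and none to the union
  factor.\<close>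

corollary FKG_down_sets:
  fixes w :: "'a set \<Rightarrow> real"
  assumes "finite I" and nonneg: "\<And>S. 0 \<le> w S"
    and log_supermodular: "\<And>S T. S \<subseteq> I \<Longrightarrow> T \<subseteq> I \<Longrightarrow> w S * w T \<le> w (S \<union> T) * w (S \<inter> T)"
    and A: "\<And>S T. S \<in> A \<Longrightarrow> T \<subseteq> S \<Longrightarrow> T \<in> A"
    and B: "\<And>S T. S \<in> B \<Longrightarrow> T \<subseteq> S \<Longrightarrow> T \<in> B"
  shows "sum w (Pow I \<inter> A) * sum w (Pow I \<inter> B) \<le> sum w (Pow I) * sum w (Pow I \<inter> (A \<inter> B))"
proof -
  let ?r = "\<lambda>C S. if S \<in> C then w S else 0"
  have "sum (?r A) (Pow I) * sum (?r B) (Pow I) \<le> sum w (Pow I) * sum (?r (A \<inter> B)) (Pow I)"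
  proof (rule four_functions[OF \<open>finite I\<close>])
    fix S T assume "S \<subseteq> I" "T \<subseteq> I"
    then show "?r A S * ?r B T \<le> w (S \<union> T) * ?r (A \<inter> B) (S \<inter> T)"
      using log_supermodular A[of S "S \<inter> T"] B[of T "S \<inter> T"] nonneg by auto
  qed (use nonneg in auto)
  then show ?thesis using \<open>finite I\<close> by (simp add: sum.inter_restrict)
qed

section \<open>Counting subgroups\<close>

definition add_subgroup :: "'a::ab_group_add set \<Rightarrow> bool" where
  "add_subgroup H \<longleftrightarrow> 0 \<in> H \<and> (\<forall>x\<in>H. \<forall>y\<in>H. x - y \<in> H)"

text \<open>Two decompositions h + k of the same element differ by an element of
  \<open>H \<inter> K\<close>, so each fibre of addition from \<open>H \<times> K\<close> to
  \<open>G\<close> has at most \<open>card (H \<inter> K)\<close> elements.\<close>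

lemma card_subgroups_le:
  fixes G H K :: "'a::ab_group_add set"
  assumes H: "add_subgroup H" and K: "add_subgroup K" and "finite G"
    and G: "\<And>h k. h \<in> H \<Longrightarrow> k \<in> K \<Longrightarrow> h + k \<in> G"
    and fin: "finite H" "finite K"
  shows "card H * card K \<le> card G * card (H \<inter> K)"
proof -
  let ?F = "\<lambda>g. {p \<in> H \<times> K. fst p + snd p = g}"
  have fiber: "card (?F g) \<le> card (H \<inter> K)" for g
  proof (cases "?F g = {}")
    case False
    then obtain h0 k0 where 0: "h0 \<in> H" "k0 \<in> K" "h0 + k0 = g" by auto
    show ?thesis
    proof (rule card_inj_on_le[where f = "\<lambda>p. fst p - h0"])
      show "inj_on (\<lambda>p. fst p - h0) (?F g)"
        by (auto simp: inj_on_def)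
      show "(\<lambda>p. fst p - h0) ` ?F g \<subseteq> H \<inter> K"
      proof
        fix x assume "x \<in> (\<lambda>p. fst p - h0) ` ?F g"
        then obtain h k where hk: "h \<in> H" "k \<in> K" and g: "h + k = g" and x: "x = h - h0" by auto
        have "h - h0 \<in> H" using H hk 0 by (auto simp: add_subgroup_def)
        moreover have "h - h0 = k0 - k" using 0 g by (simp add: algebra_simps)
        then have "h - h0 \<in> K" using K hk 0 by (auto simp: add_subgroup_def)
        ultimately show "x \<in> H \<inter> K" using x by simp
      qed
      show "finite (H \<inter> K)" using fin by simp
    qed
  next
    case True
    then show ?thesis by (simp only: card.empty)
  qed
  have "card H * card K = card (H \<times> K)" by (simp add: card_cartesian_product)
  also have "H \<times> K = (\<Union>g\<in>G. ?F g)" using G by auto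
  also have "card \<dots> \<le> (\<Sum>g\<in>G. card (?F g))" using \<open>finite G\<close> by (rule card_UN_le)
  also have "\<dots> \<le> (\<Sum>g\<in>G. card (H \<inter> K))" by (intro sum_mono fiber)
  finally show ?thesis by simp
qed

declare split_paired_All [simp del] split_paired_Ex [simp del]

section \<open>The triangular lattice\<close>

lemma hex_edges_intros:
  "{(a, b, True), (a, b, False)} \<in> hex_edges"
  "{(a, b, True), (a, b - 1, False)} \<in> hex_edges"
  "{(a, b, True), (a - 1, b, False)} \<in> hex_edges"
  unfolding hex_edges_def
  by (rule UN_I[of a UNIV], rule UNIV_I, rule UN_I[of b UNIV], rule UNIV_I, simp only: insert_iff simp_thms)+

lemma hex_edges_cases:
  assumes "e \<in> hex_edges"
  obtains a b where "e = {(a, b, True), (a, b, False)}"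
  | a b where "e = {(a, b, True), (a, b - 1, False)}"
  | a b where "e = {(a, b, True), (a - 1, b, False)}"
  using assms by (simp only: hex_edges_def UN_iff insert_iff empty_iff) metis

lemma face_borders_simps:
  "face_borders f {(a, b, True), (a, b, False)} \<longleftrightarrow> f = (a + 1, b) \<or> f = (a, b + 1)"
  "face_borders f {(a, b, True), (a, b - 1, False)} \<longleftrightarrow> f = (a, b) \<or> f = (a + 1, b)"
  "face_borders f {(a, b, True), (a - 1, b, False)} \<longleftrightarrow> f = (a, b) \<or> f = (a, b + 1)"
  by (cases f, simp add: face_borders_def hex_edges_intros corners_def, arith)+

lemma face_adj_iff:
  "face_adj (a, b) (c, d) \<longleftrightarrow>
    (c, d) \<in> {(a + 1, b), (a - 1, b), (a, b + 1), (a, b - 1), (a + 1, b - 1), (a - 1, b + 1)}"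
  (is "?L \<longleftrightarrow> ?R")
proof
  assume ?L
  then obtain e where e: "(a, b) \<noteq> (c, d)" "e \<in> hex_edges" "face_borders (a, b) e" "face_borders (c, d) e"
    by (auto simp: face_adj_def)
  from e(2) show ?R
  proof (cases rule: hex_edges_cases)
    case (1 x y)
    show ?thesis using e(1,3,4) unfolding 1 face_borders_simps by (elim disjE) simp_all
  next
    case (2 x y)
    show ?thesis using e(1,3,4) unfolding 2 face_borders_simps by (elim disjE) simp_all
  next
    case (3 x y)
    show ?thesis using e(1,3,4) unfolding 3 face_borders_simps by (elim disjE) simp_all
  qed
next
  have adj: "face_adj f g" if "e \<in> hex_edges" "face_borders f e" "face_borders g e" "f \<noteq> g" for e f g
    using that by (auto simp: face_adj_def)
  assume ?R
  then consider "(c, d) = (a + 1, b)" | "(c, d) = (a - 1, b)" | "(c, d) = (a, b + 1)"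
    | "(c, d) = (a, b - 1)" | "(c, d) = (a + 1, b - 1)" | "(c, d) = (a - 1, b + 1)"
    by auto
  then show ?L
  proof cases
    case 1
    show ?thesis by (rule adj[OF hex_edges_intros(2)[of a b]]) (use 1 in \<open>simp_all add: face_borders_simps\<close>)
  next
    case 2
    show ?thesis by (rule adj[OF hex_edges_intros(2)[of "a - 1" b]]) (use 2 in \<open>simp_all add: face_borders_simps\<close>)
  next
    case 3
    show ?thesis by (rule adj[OF hex_edges_intros(3)[of a b]]) (use 3 in \<open>simp_all add: face_borders_simps\<close>)
  next
    case 4
    show ?thesis by (rule adj[OF hex_edges_intros(3)[of a "b - 1"]]) (use 4 in \<open>simp_all add: face_borders_simps\<close>)
  next
    case 5
    show ?thesis by (rule adj[OF hex_edges_intros(1)[of a "b - 1"]]) (use 5 in \<open>simp_all add: face_borders_simps\<close>)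
  next
    case 6
    show ?thesis by (rule adj[OF hex_edges_intros(1)[of "a - 1" b]]) (use 6 in \<open>simp_all add: face_borders_simps\<close>)
  qed
qed

lemma face_adj_sym: "face_adj f g \<Longrightarrow> face_adj g f"
  by (auto simp: face_adj_def)

lemma face_adj_right: "face_adj (x, y) (x + 1, y)"
  by (simp add: face_adj_iff)

text \<open>Three of the six directions suffice for a symmetric relation: horizontal, vertical and
  antidiagonal, the ones along which \<open>closed_form_exact\<close> computes increments.\<close>

lemma face_adj_all_iff:
  assumes sym: "\<And>u v. Q u v \<Longrightarrow> Q v u"
  shows "(\<forall>u v. face_adj u v \<longrightarrow> Q u v) \<longleftrightarrow>
    (\<forall>x y. Q (x, y) (x + 1, y) \<and> Q (x, y) (x, y + 1) \<and> Q (x + 1, y) (x, y + 1))"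
    (is "?L \<longleftrightarrow> ?R")
proof
  assume ?L
  then show ?R by (simp add: face_adj_iff)
next
  assume R: ?R
  show ?L
  proof (intro allI impI)
    fix u v :: face
    assume adj: "face_adj u v"
    obtain a b c d where [simp]: "u = (a, b)" "v = (c, d)" by fastforce
    show "Q u v"
      using adj R[rule_format, of a b] R[rule_format, of "a - 1" b] R[rule_format, of a "b - 1"]
        R[rule_format, of c d]
      by (auto simp: face_adj_iff intro: sym)
  qed
qed

section \<open>Translations, neighbourhoods and boxes\<close>

definition translate :: "face \<Rightarrow> face \<Rightarrow> face" where
  "translate v f = (fst f + fst v, snd f + snd v)"

lemma translate_translate: "translate v (translate w f) = translate (v + w) f"
  by (simp add: translate_def algebra_simps)

lemma translate_0 [simp]: "translate 0 f = f"
  by (simp add: translate_def)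

lemma inj_translate: "inj (translate v)"
  by (auto simp: inj_on_def translate_def prod_eq_iff)

lemma bij_translate: "bij (translate v)"
  by (rule o_bij[of "translate (- v)"]) (auto simp: fun_eq_iff translate_translate)

lemma face_adj_translate [simp]: "face_adj (translate v f) (translate v g) \<longleftrightarrow> face_adj f g"
  by (cases f; cases g) (auto simp: translate_def face_adj_iff)

text \<open>Every coherence constraint imposed by the minus set \<open>M\<close> sits on an edge
  with both ends in \<open>nbh M\<close>; blue spins elsewhere are free.\<close>

definition nbh :: "face set \<Rightarrow> face set" where
  "nbh M = M \<union> {v. \<exists>u\<in>M. face_adj u v}"

lemma subset_nbh: "M \<subseteq> nbh M"
  by (auto simp: nbh_def)

lemma nbh_adj: "u \<in> M \<Longrightarrow> face_adj u v \<Longrightarrow> v \<in> nbh M"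
  by (auto simp: nbh_def)

lemma nbh_mono: "M \<subseteq> M' \<Longrightarrow> nbh M \<subseteq> nbh M'"
  by (auto simp: nbh_def)

lemma nbh_Un: "nbh (M \<union> M') = nbh M \<union> nbh M'"
  by (auto simp: nbh_def)

lemma nbh_translate: "nbh (translate v ` M) = translate v ` nbh M"
proof (intro equalityI subsetI)
  fix g assume "g \<in> nbh (translate v ` M)"
  moreover obtain w where w: "g = translate v w" using bij_translate[of v] by (meson bij_pointE)
  ultimately have "w \<in> nbh M" using inj_translate[of v] by (auto simp: nbh_def inj_image_mem_iff)
  then show "g \<in> translate v ` nbh M" using w by simp
next
  fix g assume "g \<in> translate v ` nbh M"
  then show "g \<in> nbh (translate v ` M)" by (auto simp: nbh_def)
qed

lemma finite_nbh [simp]: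
  assumes "finite M"
  shows "finite (nbh M)"
proof -
  let ?D = "{(0, 0), (1, 0), (-1, 0), (0, 1), (0, -1), (1, -1), (-1, 1)} :: face set"
  have "nbh M \<subseteq> (\<Union>v\<in>?D. translate v ` M)"
  proof
    fix f assume "f \<in> nbh M"
    then consider "f \<in> M" | u where "u \<in> M" "face_adj u f" by (auto simp: nbh_def)
    then obtain u v where "u \<in> M" "v \<in> ?D" "f = translate v u"
    proof cases
      case 1
      show thesis by (rule that[of f "(0, 0)"]) (use 1 in \<open>auto simp: translate_def\<close>)
    next
      case 2
      show thesis
        by (rule that[of u "(fst f - fst u, snd f - snd u)"], fact)
          (use 2 in \<open>cases u; cases f; auto simp: translate_def face_adj_iff\<close>)+
    qed
    then show "f \<in> (\<Union>v\<in>?D. translate v ` M)" by blast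
  qed
  moreover have "finite (\<Union>v\<in>?D. translate v ` M)" using assms by simp
  ultimately show ?thesis by (rule finite_subset)
qed

definition box :: "int \<Rightarrow> face set" where
  "box n = {-n..n} \<times> {-n..n}"

lemma finite_box [simp]: "finite (box n)"
  by (simp add: box_def)

lemma finite_subset_box:
  assumes "finite F"
  obtains n :: nat where "F \<subseteq> box (int n)"
proof -
  let ?g = "\<lambda>f. nat (\<bar>fst f\<bar> + \<bar>snd f\<bar>)"
  have "?g f \<le> Max (?g ` F)" if "f \<in> F" for f using assms that by (intro Max_ge) auto
  then have "F \<subseteq> box (int (Max (?g ` F)))"
    by (force simp: box_def)
  then show ?thesis by (rule that)
qed

section \<open>The weight of a spin configuration\<close>

lemma bit_add_self [simp]: "a + a = (0::bit)"
  by (cases a) simp_all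

lemma bit_add_eq_0_iff: "a + b = 0 \<longleftrightarrow> a = (b::bit)"
  by (cases a; cases b) simp_all

lemma UNIV_bit: "(UNIV :: bit set) = {0, 1}"
proof -
  have "x \<in> {0, 1}" for x :: bit by (cases x) simp_all
  then show ?thesis by auto
qed

definition supported :: "face set \<Rightarrow> (face \<Rightarrow> bit) set" where
  "supported F = {b. \<forall>f. f \<notin> F \<longrightarrow> b f = 0}"

lemma finite_supported [simp]: "finite F \<Longrightarrow> finite (supported F)"
proof -
  assume "finite F"
  then have "finite {b::face \<Rightarrow> bit. \<forall>f. (f \<in> F \<longrightarrow> b f \<in> UNIV) \<and> (f \<notin> F \<longrightarrow> b f = 0)}"
    by (intro finite_set_of_finite_funs) (auto simp: UNIV_bit)
  then show ?thesis by (simp add: supported_def)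
qed

text \<open>A red configuration is given by its finite set \<open>M\<close> of minus faces, a blue one by the indicator
  function of its minus faces; \<open>compat F M\<close> collects the blue configurations on \<open>F\<close> coherent with \<open>M\<close>.\<close>

definition compat :: "face set \<Rightarrow> face set \<Rightarrow> (face \<Rightarrow> bit) set" where
  "compat F M = {b \<in> supported F. \<forall>u v. face_adj u v \<longrightarrow> u \<in> M \<longrightarrow> v \<notin> M \<longrightarrow> b u = b v}"

text \<open>The probability that a uniform blue configuration is coherent with \<open>M\<close>. A
  face outside \<open>nbh M\<close> doubles both the coherent and the total count, so any larger
  finite region gives the same ratio (\<open>card_compat\<close>), and the weight does not mention a
  domain.\<close>

definition wt :: "face set \<Rightarrow> real" where
  "wt M = card (compat (nbh M) M) / 2 ^ card (nbh M)"

lemma finite_compat [simp]: "finite F \<Longrightarrow> finite (compat F M)"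
  by (rule finite_subset[of _ "supported F"]) (auto simp: compat_def)

lemma card_compat_insert:
  assumes "finite F" "nbh M \<subseteq> F" "x \<notin> F"
  shows "card (compat (insert x F) M) = 2 * card (compat F M)"
proof -
  let ?u = "\<lambda>b::face \<Rightarrow> bit. b(x := 1)"
  have x: "u \<noteq> x" "v \<noteq> x" if "u \<in> M" "face_adj u v" for u v
    using that assms subset_nbh[of M] nbh_adj[of u M v] by auto
  have eq: "compat (insert x F) M = compat F M \<union> ?u ` compat F M"
  proof (intro equalityI subsetI)
    fix b assume b: "b \<in> compat (insert x F) M"
    show "b \<in> compat F M \<union> ?u ` compat F M"
    proof (cases "b x = 0")
      case True
      then have "b \<in> compat F M" using b by (auto simp: compat_def supported_def)
      then show ?thesis by simp
    next
      case False
      then have "b = ?u (b(x := 0))" by (auto simp: fun_eq_iff)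
      moreover have "b(x := 0) \<in> compat F M" using b x by (auto simp: compat_def supported_def)
      ultimately show ?thesis by blast
    qed
  next
    fix b assume "b \<in> compat F M \<union> ?u ` compat F M"
    then show "b \<in> compat (insert x F) M" using x by (auto simp: compat_def supported_def)
  qed
  have x0: "b x = 0" if "b \<in> compat F M" for b using that assms by (auto simp: compat_def supported_def)
  have "inj_on ?u (compat F M)"
  proof (rule inj_onI, rule ext)
    fix b c y assume b: "b \<in> compat F M" "c \<in> compat F M" "?u b = ?u c"
    show "b y = c y"
    proof (cases "y = x")
      case False
      then show ?thesis using fun_cong[OF b(3), of y] by simp
    qed (use x0[OF b(1)] x0[OF b(2)] in simp)
  qed
  moreover have "compat F M \<inter> ?u ` compat F M = {}"
    by (auto dest: x0)
  ultimately show ?thesis using assms by (simp add: eq card_Un_disjoint card_image)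
qed

lemma card_compat:
  assumes "finite F" "nbh M \<subseteq> F"
  shows "real (card (compat F M)) = wt M * 2 ^ card F"
proof -
  have fin: "finite (nbh M)" using assms finite_subset by blast
  have "real (card (compat (nbh M \<union> D) M)) = wt M * 2 ^ card (nbh M \<union> D)"
    if "finite D" "D \<inter> nbh M = {}" for D
    using that
  proof (induction D rule: finite_induct)
    case empty
    then show ?case by (simp add: wt_def)
  next
    case (insert x D)
    then have "x \<notin> nbh M \<union> D" by auto
    then show ?case using insert fin card_compat_insert[of "nbh M \<union> D" M x] by simp
  qed
  moreover have "(F - nbh M) \<inter> nbh M = {}" by auto
  ultimately have "real (card (compat (nbh M \<union> (F - nbh M)) M)) = wt M * 2 ^ card (nbh M \<union> (F - nbh M))"
    by (metis assms(1) finite_Diff)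
  then show ?thesis using assms(2) by (simp add: Un_absorb1)
qed

lemma wt_pos: "finite M \<Longrightarrow> wt M > 0"
proof -
  assume "finite M"
  moreover have "0 \<in> compat (nbh M) M" by (simp add: compat_def supported_def)
  ultimately show ?thesis unfolding wt_def
    by (auto intro!: divide_pos_pos simp: card_gt_0_iff)
qed

text \<open>The constraints of \<open>M\<close> and \<open>M'\<close> then involve disjoint sets of
  blue spins. Disjointness of the sets alone would not do: a common neighbour couples them, and an
  edge between them stops being a constraint in the union. This is the source of independence at a
  distance.\<close>

lemma wt_Un_disjoint:
  assumes fin: "finite M" "finite M'" and disj: "nbh M \<inter> nbh M' = {}"
  shows "wt (M \<union> M') = wt M * wt M'"
proof -
  let ?F = "nbh M \<union> nbh M'"
  let ?C = "compat (nbh M) M" and ?D = "compat (nbh M') M'"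
  let ?r = "\<lambda>N (b::face \<Rightarrow> bit) f. if f \<in> nbh N then b f else 0"
  have out: "b f = 0" if "b \<in> compat F N" "f \<notin> F" for b f F N
    using that by (simp add: compat_def supported_def)
  have const: "b u = b v" if "b \<in> compat F N" "face_adj u v" "u \<in> N" "v \<notin> N" for b u v F N
    using that by (simp add: compat_def)
  have "bij_betw (\<lambda>(b, c). b + c) (?C \<times> ?D) (compat ?F (M \<union> M'))"
  proof (rule bij_betwI[where g = "\<lambda>b. (?r M b, ?r M' b)"])
    have "b + c \<in> compat ?F (M \<union> M')" if b: "b \<in> ?C" and c: "c \<in> ?D" for b c
    proof -
      have "b u + c u = b v + c v" if adj: "face_adj u v" and u: "u \<in> M \<union> M'" and v: "v \<notin> M \<union> M'" for u v
      proof (cases "u \<in> M")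
        case True
        then have "u \<in> nbh M" "v \<in> nbh M" using adj by (auto simp: nbh_def)
        then have "c u = 0" "c v = 0" using out[OF c] disj by blast+
        then show ?thesis using const[OF b adj True] v by simp
      next
        case False
        then have u': "u \<in> M'" using u by simp
        then have "u \<in> nbh M'" "v \<in> nbh M'" using adj by (auto simp: nbh_def)
        then have "b u = 0" "b v = 0" using out[OF b] disj by blast+
        then show ?thesis using const[OF c adj u'] v by simp
      qed
      then show ?thesis
        using out[OF b] out[OF c] by (simp add: compat_def supported_def)
    qed
    then show "(\<lambda>(b, c). b + c) \<in> ?C \<times> ?D \<rightarrow> compat ?F (M \<union> M')" by fast
  next
    have r: "?r N b \<in> compat (nbh N) N"
      if b: "b \<in> compat ?F (M \<union> M')" and N: "nbh N \<inter> N' = {}" "N \<union> N' = M \<union> M'" for b N N'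
    proof -
      \<comment> \<open>A face \<open>v\<close> in \<open>nbh N\<close> but outside \<open>N\<close>
        is not in \<open>N'\<close> either, so the edge is also a constraint for
        \<open>M \<union> M'\<close>.\<close>
      have "?r N b u = ?r N b v" if uv: "face_adj u v" "u \<in> N" "v \<notin> N" for u v
      proof -
        have "u \<in> nbh N" "v \<in> nbh N" using uv by (auto simp: nbh_def)
        moreover from this have "u \<in> M \<union> M'" "v \<notin> M \<union> M'" using uv N by auto
        ultimately show ?thesis using const[OF b uv(1)] by simp
      qed
      then show ?thesis by (simp add: compat_def supported_def)
    qed
    show "(\<lambda>b. (?r M b, ?r M' b)) \<in> compat ?F (M \<union> M') \<rightarrow> ?C \<times> ?D"
    proof
      fix b assume b: "b \<in> compat ?F (M \<union> M')"
      show "(?r M b, ?r M' b) \<in> ?C \<times> ?D"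
        using r[OF b, of M M'] r[OF b, of M' M] disj subset_nbh[of M] subset_nbh[of M'] by blast
    qed
  next
    fix p assume "p \<in> ?C \<times> ?D"
    then obtain b c where p: "p = (b, c)" and b: "b \<in> ?C" and c: "c \<in> ?D" by auto
    have "?r M (b + c) f = b f" "?r M' (b + c) f = c f" for f
    proof -
      have "f \<notin> nbh M \<or> f \<notin> nbh M'" using disj by blast
      then show "?r M (b + c) f = b f" "?r M' (b + c) f = c f"
        using out[OF b, of f] out[OF c, of f] by auto
    qed
    then have "?r M (b + c) = b" "?r M' (b + c) = c" by blast+
    then show "(?r M (case p of (b, c) \<Rightarrow> b + c), ?r M' (case p of (b, c) \<Rightarrow> b + c)) = p"
      unfolding p prod.case by simp
  next
    fix b assume b: "b \<in> compat ?F (M \<union> M')"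
    have "(?r M b + ?r M' b) f = b f" for f
      using out[OF b, of f] disj by auto
    then have "?r M b + ?r M' b = b" by blast
    then show "(case (?r M b, ?r M' b) of (b, c) \<Rightarrow> b + c) = b" by simp
  qed
  then have "card (compat ?F (M \<union> M')) = card ?C * card ?D"
    by (simp add: bij_betw_same_card[symmetric] card_cartesian_product)
  moreover have "card ?F = card (nbh M) + card (nbh M')"
    using fin disj by (simp add: card_Un_disjoint)
  ultimately show ?thesis by (simp add: wt_def nbh_Un power_add)
qed

lemma wt_translate: "wt (translate v ` M) = wt M"
proof -
  let ?t = "translate v"
  have inv: "inv ?t (?t f) = f" "?t (inv ?t f) = f" for f
    using bij_translate[of v] by (auto simp: bij_def surj_f_inv_f)
  have t: "f \<in> ?t ` N \<longleftrightarrow> inv ?t f \<in> N" for f N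
    by (metis inv image_eqI imageE)
  have "bij_betw (\<lambda>b. b \<circ> ?t) (compat (nbh (?t ` M)) (?t ` M)) (compat (nbh M) M)"
  proof (rule bij_betwI[where g = "\<lambda>b. b \<circ> inv ?t"])
    show "(\<lambda>b. b \<circ> ?t) \<in> compat (nbh (?t ` M)) (?t ` M) \<rightarrow> compat (nbh M) M"
      using inv by (auto simp: compat_def supported_def nbh_translate t)
    have "face_adj (inv ?t f) (inv ?t g) \<longleftrightarrow> face_adj f g" for f g
      using face_adj_translate[of v "inv ?t f" "inv ?t g"] by (simp only: inv)
    then show "(\<lambda>b. b \<circ> inv ?t) \<in> compat (nbh M) M \<rightarrow> compat (nbh (?t ` M)) (?t ` M)"
      by (auto simp: compat_def supported_def nbh_translate t)
  qed (auto simp: fun_eq_iff inv)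
  then show ?thesis
    by (simp add: wt_def bij_betw_same_card nbh_translate card_image[OF inj_on_subset[OF inj_translate]])
qed

section \<open>Log-supermodularity of the weight\<close>

text \<open>The discrete Poincare lemma with finite support: integrate each row from its left end.\<close>

lemma closed_form_exact:
  fixes \<eta> :: "face \<Rightarrow> face \<Rightarrow> bit"
  assumes sym: "\<And>u v. \<eta> u v = \<eta> v u"
    and supp: "\<And>u v. \<eta> u v \<noteq> 0 \<Longrightarrow> u \<in> box n \<and> v \<in> box n"
    and up: "\<And>x y. \<eta> (x, y) (x + 1, y) + \<eta> (x, y) (x, y + 1) + \<eta> (x + 1, y) (x, y + 1) = 0"
    and down: "\<And>x y. \<eta> (x + 1, y) (x, y + 1) + \<eta> (x, y + 1) (x + 1, y + 1)
      + \<eta> (x + 1, y) (x + 1, y + 1) = 0"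
  obtains c where "c \<in> supported (box n)" "\<And>u v. face_adj u v \<Longrightarrow> c u + c v = \<eta> u v"
proof -
  \<comment> \<open>For \<open>fst f \<le> -n\<close> the sum is empty, so \<open>c\<close> vanishes
    to the left of the box.\<close>
  define c :: "face \<Rightarrow> bit" where "c f = (\<Sum>j\<in>{-n..<fst f}. \<eta> (j, snd f) (j + 1, snd f))" for f
  have zero: "\<eta> u v = 0" if "u \<notin> box n" for u v using supp[of u v] that by blast
  have right: "c (x + 1, y) = c (x, y) + \<eta> (x, y) (x + 1, y)" for x y
  proof (cases "x \<ge> -n")
    case True
    then have "{-n..<x + 1} = insert x {-n..<x}" by auto
    then have "c (x + 1, y) = (\<Sum>j\<in>insert x {-n..<x}. \<eta> (j, y) (j + 1, y))" by (simp only: c_def fst_conv snd_conv)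
    also have "\<dots> = \<eta> (x, y) (x + 1, y) + c (x, y)" unfolding c_def by (subst sum.insert) simp_all
    finally show ?thesis by (simp only: add.commute)
  next
    case False
    then have "(x, y) \<notin> box n" by (simp add: box_def)
    then show ?thesis using False by (simp add: c_def zero)
  qed
  \<comment> \<open>Adding the two triangles of a unit cell cancels their common antidiagonal
    edge.\<close>
  have square: "\<eta> (x + 1, y) (x + 1, y + 1) =
      \<eta> (x, y) (x + 1, y) + \<eta> (x, y) (x, y + 1) + \<eta> (x, y + 1) (x + 1, y + 1)" for x y
    using up[of x y] down[of x y]
    by (cases "\<eta> (x, y) (x + 1, y)"; cases "\<eta> (x, y) (x, y + 1)"; cases "\<eta> (x + 1, y) (x, y + 1)";
        cases "\<eta> (x, y + 1) (x + 1, y + 1)"; cases "\<eta> (x + 1, y) (x + 1, y + 1)") simp_all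
  have ac: "(p + q) + (r + s) = (p + r) + (q + s)" for p q r s :: bit by (simp only: add_ac)
  have ac': "p + (q + r) = q + p + r" for p q r :: bit by (simp only: add_ac)
  \<comment> \<open>Induction along the row from column \<open>-n - 1\<close>, where all terms
    vanish; \<open>square\<close> carries the identity from one column to the next.\<close>
  have vert: "c (x, y) + c (x, y + 1) = \<eta> (x, y) (x, y + 1)" for x y
  proof (cases "x \<ge> -n - 1")
    case True
    then show ?thesis
    proof (induction x rule: int_ge_induct)
      case base
      then show ?case by (simp add: c_def zero box_def)
    next
      case (step x)
      have "c (x + 1, y) + c (x + 1, y + 1) =
          (c (x, y) + c (x, y + 1)) + (\<eta> (x, y) (x + 1, y) + \<eta> (x, y + 1) (x + 1, y + 1))"
        unfolding right by (rule ac)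
      also have "\<dots> = \<eta> (x + 1, y) (x + 1, y + 1)"
        unfolding square step.IH by (rule ac')
      finally show ?case .
    qed
  next
    case False
    then show ?thesis by (simp add: c_def zero box_def)
  qed
  have diag: "c (x + 1, y) + c (x, y + 1) = \<eta> (x + 1, y) (x, y + 1)" for x y
    using right[of x y] vert[of x y] up[of x y]
    by (cases "\<eta> (x, y) (x + 1, y)"; cases "\<eta> (x, y) (x, y + 1)"; cases "\<eta> (x + 1, y) (x, y + 1)";
        cases "c (x, y)"; cases "c (x, y + 1)"; cases "c (x + 1, y)") simp_all
  have "c f = 0" if f: "f \<notin> box n" for f
  proof -
    obtain x y where xy: "f = (x, y)" by fastforce
    have outside: "c (x, y) = 0" if "y \<notin> {-n..n}" for y
      using that by (auto simp: c_def zero box_def)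
    consider "y \<notin> {-n..n}" | "x < -n" | "x > n" using f xy by (force simp: box_def)
    then show ?thesis
    proof cases
      case 1
      then show ?thesis using outside xy by simp
    next
      case 2
      then show ?thesis using xy by (simp add: c_def)
    next
      case 3
      \<comment> \<open>To the right of the box the row sums could a priori be nonzero. They vanish
        in row \<open>n + 1\<close>, and vertical increments are zero in these columns, so the value
        0 descends to all lower rows.\<close>
      have "c (x, y) = 0" if "y \<le> n + 1" for y
        using that
      proof (induction y rule: int_le_induct)
        case base
        then show ?case using outside[of "n + 1"] by simp
      next
        case (step y)
        have "\<eta> (x, y - 1) (x, y - 1 + 1) = 0" using 3 by (intro zero) (simp add: box_def)
        with vert[of x "y - 1"] show ?case using step by simp
      qed
      then show ?thesis using outside[of y] xy by (cases "y \<le> n + 1") auto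
    qed
  qed
  then have "c \<in> supported (box n)" by (simp add: supported_def)
  moreover have "\<forall>u v. face_adj u v \<longrightarrow> c u + c v = \<eta> u v"
    using right vert diag
    by (subst face_adj_all_iff) (auto simp: sym add.commute)
  ultimately show thesis using that by blast
qed

text \<open>The fields whose differential lives on edges inside \<open>X\<close>. Vanishing outside
  the box takes the place of the quotient by constants, so fields and differentials determine each
  other.\<close>

definition const_off :: "int \<Rightarrow> face set \<Rightarrow> (face \<Rightarrow> bit) set" where
  "const_off n X = {b \<in> supported (box n). \<forall>u v. face_adj u v \<longrightarrow> \<not> (u \<in> X \<and> v \<in> X) \<longrightarrow> b u = b v}"

lemma finite_const_off [simp]: "finite (const_off n X)"
  by (rule finite_subset[of _ "supported (box n)"]) (auto simp: const_off_def)

lemma add_subgroup_const_off: "add_subgroup (const_off n X)"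
  by (auto simp: add_subgroup_def const_off_def supported_def)

lemma const_off_Int: "const_off n X \<inter> const_off n Y = const_off n (X \<inter> Y)"
  unfolding const_off_def by blast

lemma const_off_add:
  assumes "b \<in> const_off n X" "c \<in> const_off n Y"
  shows "b + c \<in> const_off n (X \<union> Y)"
  using assms by (auto simp: const_off_def supported_def)

text \<open>The edges inside both sets are those inside the intersection, but an edge from
  \<open>X - Y\<close> to \<open>Y - X\<close> is inside the union only. Hence the groups intersect
  exactly while their sum may be a proper subgroup, which leaves an inequality.\<close>

lemma card_const_off_supermodular:
  "card (const_off n X) * card (const_off n Y) \<le> card (const_off n (X \<union> Y)) * card (const_off n (X \<inter> Y))"
  using card_subgroups_le[of "const_off n X" "const_off n Y" "const_off n (X \<union> Y)"]
  by (simp add: const_off_Int add_subgroup_const_off const_off_add)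

text \<open>Such a field is constant along each row, and every row leaves the box. This makes the
  splitting in \<open>card_compat_eq\<close> unique.\<close>

lemma const_off_empty: "const_off n {} = {0}"
proof -
  have "b = 0" if b: "b \<in> const_off n {}" for b
  proof -
    have out: "b f = 0" if "f \<notin> box n" for f using b that by (simp add: const_off_def supported_def)
    have "b (x, y) = 0" if "x \<le> n + 1" for x y
      using that
    proof (induction x rule: int_le_induct)
      case base
      show ?case by (rule out) (simp add: box_def)
    next
      case (step x)
      have "b (x - 1, y) = b (x - 1 + 1, y)"
        using b face_adj_right[of "x - 1" y] unfolding const_off_def by blast
      then show ?case using step by simp
    qed
    moreover have "b (x, y) = 0" if "\<not> x \<le> n + 1" for x y
      by (rule out) (use that in \<open>simp add: box_def\<close>)
    ultimately have "b (x, y) = 0" for x y by blast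
    then show ?thesis by (auto simp: fun_eq_iff)
  qed
  then show ?thesis by (auto simp: const_off_def supported_def)
qed

text \<open>The differential of a blue configuration coherent with \<open>M\<close> lives on edges inside \<open>M\<close> and on edges
  inside the complement. Both parts are closed, as no triangle has edges of both kinds, hence exact.\<close>

lemma card_compat_eq:
  assumes M: "M \<subseteq> box n"
  shows "card (compat (box n) M) = card (const_off n M) * card (const_off n (- M))"
proof -
  have "bij_betw (\<lambda>(p, q). p + q) (const_off n M \<times> const_off n (- M)) (compat (box n) M)"
    unfolding bij_betw_def
  proof (intro conjI equalityI)
    show "inj_on (\<lambda>(p, q). p + q) (const_off n M \<times> const_off n (- M))"
    proof (rule inj_onI, clarify)
      fix p q p' q'
      assume p: "p \<in> const_off n M" "p' \<in> const_off n M" and q: "q \<in> const_off n (- M)" "q' \<in> const_off n (- M)"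
        and eq: "p + q = p' + q'"
      have "p - p' = q' - q" using eq by (metis add_diff_cancel_left' add_diff_eq diff_add_cancel diff_diff_eq2)
      moreover have "p - p' \<in> const_off n M" using p add_subgroup_const_off[of n M] by (simp add: add_subgroup_def)
      moreover have "q' - q \<in> const_off n (- M)" using q add_subgroup_const_off[of n "- M"] by (simp add: add_subgroup_def)
      ultimately have "p - p' \<in> const_off n (M \<inter> - M)" unfolding const_off_Int[symmetric] by simp
      then have "p = p'" by (simp add: const_off_empty)
      then show "p = p' \<and> q = q'" using eq by simp
    qed
    have "p + q \<in> compat (box n) M" if "p \<in> const_off n M" "q \<in> const_off n (- M)" for p q
    proof -
      have "p u + q u = p v + q v" if "face_adj u v" "u \<in> M" "v \<notin> M" for u v
      proof -
        have "p u = p v" "q u = q v" using that \<open>p \<in> _\<close> \<open>q \<in> _\<close> unfolding const_off_def by blast+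
        then show ?thesis by simp
      qed
      then show ?thesis using that by (simp add: compat_def const_off_def supported_def)
    qed
    then show "(\<lambda>(p, q). p + q) ` (const_off n M \<times> const_off n (- M)) \<subseteq> compat (box n) M" by auto
    show "compat (box n) M \<subseteq> (\<lambda>(p, q). p + q) ` (const_off n M \<times> const_off n (- M))"
    proof
      fix b assume b: "b \<in> compat (box n) M"
      then have b1: "b u = b v" if "face_adj u v" "u \<in> M" "v \<notin> M" for u v
        using that by (simp add: compat_def)
      have b2: "b u = b v" if "face_adj u v" "u \<in> M \<longleftrightarrow> v \<notin> M" for u v
        using that b1[of u v] b1[of v u] face_adj_sym by metis
      define \<eta> where "\<eta> u v = (if u \<in> M \<and> v \<in> M then b u + b v else 0)" for u v
      \<comment> \<open>A triangle has one or three edges with ends on the same side of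
        \<open>M\<close>. If exactly two corners lie in \<open>M\<close>, both equal the third
        corner under \<open>b\<close> by \<open>b2\<close>, so the single edge inside
        \<open>M\<close> also carries 0.\<close>
      have tri: "\<eta> u v + \<eta> u w + \<eta> v w = 0" if "face_adj u v" "face_adj u w" "face_adj v w" for u v w
        using b2[OF that(1)] b2[OF that(2)] b2[OF that(3)]
        by (cases "b u"; cases "b v"; cases "b w"; cases "u \<in> M"; cases "v \<in> M"; cases "w \<in> M")
          (simp_all add: \<eta>_def)
      obtain c where c: "c \<in> supported (box n)" "\<And>u v. face_adj u v \<Longrightarrow> c u + c v = \<eta> u v"
      proof (rule closed_form_exact[of \<eta> n])
        show "\<eta> (x, y) (x + 1, y) + \<eta> (x, y) (x, y + 1) + \<eta> (x + 1, y) (x, y + 1) = 0" for x y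
          by (rule tri) (simp_all add: face_adj_iff)
        show "\<eta> (x + 1, y) (x, y + 1) + \<eta> (x, y + 1) (x + 1, y + 1) + \<eta> (x + 1, y) (x + 1, y + 1) = 0" for x y
        proof -
          have "\<eta> (x + 1, y) (x, y + 1) + \<eta> (x + 1, y) (x + 1, y + 1) + \<eta> (x, y + 1) (x + 1, y + 1) = 0"
            by (rule tri) (simp_all add: face_adj_iff)
          then show ?thesis by (simp only: add_ac)
        qed
      qed (use M in \<open>auto simp: \<eta>_def add.commute split: if_splits\<close>)
      have "c u = c v" if "face_adj u v" "\<not> (u \<in> M \<and> v \<in> M)" for u v
        using c(2)[OF that(1)] that(2) by (auto simp: \<eta>_def bit_add_eq_0_iff)
      then have "c \<in> const_off n M" using c(1) by (simp add: const_off_def)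
      \<comment> \<open>If both ends lie in \<open>M\<close>, then \<open>c\<close> has the same
        increment as \<open>b\<close>; if exactly one does, both increments are 0.\<close>
      moreover have "b u - c u = b v - c v" if "face_adj u v" "\<not> (u \<notin> M \<and> v \<notin> M)" for u v
        using c(2)[OF that(1)] that b2[OF that(1)]
        by (cases "b u"; cases "b v"; cases "c u"; cases "c v") (auto simp: \<eta>_def split: if_splits)
      then have "b - c \<in> const_off n (- M)" using b c(1) by (simp add: const_off_def compat_def supported_def)
      moreover have "b = c + (b - c)" by simp
      ultimately show "b \<in> (\<lambda>(p, q). p + q) ` (const_off n M \<times> const_off n (- M))" by (metis case_prod_conv image_eqI mem_Times_iff fst_conv snd_conv)
    qed
  qed
  then show ?thesis by (simp add: bij_betw_same_card[symmetric] card_cartesian_product)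
qed

theorem wt_log_supermodular:
  assumes "finite M" "finite M'"
  shows "wt M * wt M' \<le> wt (M \<union> M') * wt (M \<inter> M')"
proof -
  obtain n :: nat where n: "nbh (M \<union> M') \<subseteq> box (int n)"
    using finite_subset_box[of "nbh (M \<union> M')"] assms by auto
  let ?n = "int n"
  have sub: "nbh N \<subseteq> box ?n" "N \<subseteq> box ?n" if "N \<subseteq> M \<union> M'" for N
    using n nbh_mono[OF that] subset_nbh[of N] by auto
  \<comment> \<open>One common box for \<open>M\<close>, \<open>M'\<close>, their union and their
    intersection gives all four weights the same normalisation.\<close>
  have w: "wt N * 2 ^ card (box ?n) = real (card (const_off ?n N) * card (const_off ?n (- N)))"
    if "N \<subseteq> M \<union> M'" for N
    using card_compat[OF finite_box sub(1)[OF that]] card_compat_eq[OF sub(2)[OF that]] by simp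
  have "(card (const_off ?n M) * card (const_off ?n (- M))) * (card (const_off ?n M') * card (const_off ?n (- M')))
     = (card (const_off ?n M) * card (const_off ?n M')) * (card (const_off ?n (- M)) * card (const_off ?n (- M')))"
    by simp
  \<comment> \<open>The groups are regrouped by side: minus factors together, plus factors together.
    In the second pair the union of complements belongs to \<open>M \<inter> M'\<close> and the
    intersection to \<open>M \<union> M'\<close>.\<close>
  also have "\<dots> \<le> (card (const_off ?n (M \<union> M')) * card (const_off ?n (M \<inter> M')))
     * (card (const_off ?n (- M \<union> - M')) * card (const_off ?n (- M \<inter> - M')))"
    by (intro mult_le_mono card_const_off_supermodular)
  also have "\<dots> = (card (const_off ?n (M \<union> M')) * card (const_off ?n (- (M \<union> M'))))
     * (card (const_off ?n (M \<inter> M')) * card (const_off ?n (- (M \<inter> M'))))"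
    by simp
  finally have "(wt M * 2 ^ card (box ?n)) * (wt M' * 2 ^ card (box ?n))
      \<le> (wt (M \<union> M') * 2 ^ card (box ?n)) * (wt (M \<inter> M') * 2 ^ card (box ?n))"
    by (subst (1 2 3 4) w) (auto simp flip: of_nat_mult)
  then have "(wt M * wt M') * (2 ^ card (box ?n) * 2 ^ card (box ?n))
      \<le> (wt (M \<union> M') * wt (M \<inter> M')) * (2 ^ card (box ?n) * 2 ^ card (box ?n))"
    by (simp only: mult_ac)
  then show ?thesis by (rule mult_right_le_imp_le) simp
qed

section \<open>Finite-volume measures\<close>

definition cfg_of :: "face set \<Rightarrow> face \<Rightarrow> bool" where
  "cfg_of M = (\<lambda>f. f \<notin> M)"

definition Zsum :: "face set \<Rightarrow> real" where
  "Zsum I = sum wt (Pow I)"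

definition fv :: "face set \<Rightarrow> (face \<Rightarrow> bool) set \<Rightarrow> real" where
  "fv I A = sum wt (Pow I \<inter> {M. cfg_of M \<in> A}) / Zsum I"

text \<open>These increasing events suffice for computations: their indicators span those of all
  cylinder events, and their probabilities are ratios of partition functions
  (\<open>fv_all_plus\<close>).\<close>

definition all_plus :: "face set \<Rightarrow> (face \<Rightarrow> bool) set" where
  "all_plus U = {\<omega>. \<forall>f\<in>U. \<omega> f}"

lemma all_plus_Un: "all_plus (U \<union> V) = all_plus U \<inter> all_plus V"
  by (auto simp: all_plus_def)

lemma increasing_all_plus: "increasing_event (all_plus U)"
  by (auto simp: increasing_event_def all_plus_def le_fun_def)

lemma wt_nonneg: "0 \<le> wt M"
  by (simp add: wt_def)

lemma Zsum_pos: "finite I \<Longrightarrow> Zsum I > 0"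
proof -
  assume "finite I"
  then have "wt {} \<le> Zsum I" unfolding Zsum_def by (intro member_le_sum) (auto simp: wt_nonneg)
  then show ?thesis using wt_pos[of "{}"] by simp
qed

lemma fv_nonneg: "0 \<le> fv I A"
  by (auto simp: fv_def Zsum_def wt_nonneg intro!: divide_nonneg_nonneg sum_nonneg)

lemma fv_eq_sum: "fv I A = (\<Sum>M\<in>Pow I. wt M * indicat_real A (cfg_of M)) / Zsum I" if "finite I"
  using that by (simp add: fv_def sum.inter_restrict indicator_def if_distrib cong: if_cong)

lemma fv_UNIV: "finite I \<Longrightarrow> fv I UNIV = 1"
  using Zsum_pos[of I] by (simp add: fv_def Zsum_def)

lemma down_set:
  assumes "increasing_event A" "M \<in> {M. cfg_of M \<in> A}" "M' \<subseteq> M"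
  shows "M' \<in> {M. cfg_of M \<in> A}"
proof -
  have "cfg_of M \<le> cfg_of M'" using assms by (auto simp: cfg_of_def le_fun_def)
  then show ?thesis using assms by (auto simp: increasing_event_def)
qed

lemma FKG_sum:
  assumes "finite I" "increasing_event A" "increasing_event B"
  shows "sum wt (Pow I \<inter> {M. cfg_of M \<in> A}) * sum wt (Pow I \<inter> {M. cfg_of M \<in> B})
    \<le> Zsum I * sum wt (Pow I \<inter> {M. cfg_of M \<in> A \<inter> B})"
proof -
  have "sum wt (Pow I \<inter> {M. cfg_of M \<in> A}) * sum wt (Pow I \<inter> {M. cfg_of M \<in> B})
    \<le> sum wt (Pow I) * sum wt (Pow I \<inter> ({M. cfg_of M \<in> A} \<inter> {M. cfg_of M \<in> B}))"
    using assms finite_subset[OF _ assms(1)]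
    by (intro FKG_down_sets) (auto intro: wt_nonneg wt_log_supermodular dest: down_set)
  then show ?thesis by (simp add: Zsum_def Collect_conj_eq)
qed

lemma fv_FKG:
  assumes "finite I" "increasing_event A" "increasing_event B"
  shows "fv I A * fv I B \<le> fv I (A \<inter> B)"
  using FKG_sum[OF assms] Zsum_pos[OF assms(1)] by (simp add: fv_def field_simps)

text \<open>Restricting to \<open>I\<close> amounts to conditioning on the increasing event that \<open>J - I\<close> is plus.\<close>

lemma fv_antimono:
  assumes "finite J" "I \<subseteq> J" "increasing_event A"
  shows "fv J A \<le> fv I A"
proof -
  have eq: "Pow J \<inter> {M. cfg_of M \<in> all_plus (J - I)} = Pow I"
    using assms by (auto simp: cfg_of_def all_plus_def)
  have eq': "Pow J \<inter> {M. cfg_of M \<in> A \<inter> all_plus (J - I)} = Pow I \<inter> {M. cfg_of M \<in> A}"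
    using eq by auto
  have "sum wt (Pow J \<inter> {M. cfg_of M \<in> A}) * Zsum I \<le> Zsum J * sum wt (Pow I \<inter> {M. cfg_of M \<in> A})"
    using FKG_sum[OF assms(1,3) increasing_all_plus[of "J - I"]] unfolding eq eq' Zsum_def[of I] .
  then show ?thesis
    using Zsum_pos[OF assms(1)] Zsum_pos[OF finite_subset[OF assms(2,1)]] by (simp add: fv_def field_simps)
qed

lemma fv_all_plus: "fv I (all_plus U) = Zsum (I - U) / Zsum I"
proof -
  have "Pow I \<inter> {M. cfg_of M \<in> all_plus U} = Pow (I - U)" by (auto simp: cfg_of_def all_plus_def)
  then show ?thesis by (simp add: fv_def Zsum_def)
qed

lemma Zsum_Un:
  assumes "finite I" "finite J" "nbh I \<inter> nbh J = {}"
  shows "Zsum (I \<union> J) = Zsum I * Zsum J"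
proof -
  have disj: "I \<inter> J = {}" using assms subset_nbh by blast
  have "bij_betw (\<lambda>(M, M'). M \<union> M') (Pow I \<times> Pow J) (Pow (I \<union> J))"
    by (rule bij_betwI[where g = "\<lambda>M. (M \<inter> I, M \<inter> J)"]) (use disj in auto)
  then have "Zsum (I \<union> J) = (\<Sum>(M, M')\<in>Pow I \<times> Pow J. wt (M \<union> M'))"
    unfolding Zsum_def by (subst sum.reindex_bij_betw[symmetric]) (auto simp: case_prod_unfold)
  also have "\<dots> = (\<Sum>(M, M')\<in>Pow I \<times> Pow J. wt M * wt M')"
  proof (rule sum.cong[OF refl], clarify)
    fix M M' assume "M \<subseteq> I" "M' \<subseteq> J"
    then show "wt (M \<union> M') = wt M * wt M'"
      using assms nbh_mono[of M I] nbh_mono[of M' J] finite_subset by (intro wt_Un_disjoint) blast+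
  qed
  finally show ?thesis by (simp add: Zsum_def sum_product sum.cartesian_product)
qed

lemma fv_all_plus_Un:
  assumes "finite I" "finite J" "nbh I \<inter> nbh J = {}" "U \<subseteq> I" "V \<subseteq> J"
  shows "fv (I \<union> J) (all_plus (U \<union> V)) = fv I (all_plus U) * fv J (all_plus V)"
proof -
  have "I \<inter> J = {}" using assms subset_nbh by blast
  then have eq: "(I \<union> J) - (U \<union> V) = (I - U) \<union> (J - V)" using assms by blast
  have "nbh (I - U) \<inter> nbh (J - V) = {}"
    using assms nbh_mono[of "I - U" I] nbh_mono[of "J - V" J] by blast
  then show ?thesis using assms by (simp add: fv_all_plus eq Zsum_Un)
qed

lemma shift_cfg_translate: "shift_cfg v \<omega> f = \<omega> (translate v f)"
  by (simp add: shift_cfg_def translate_def)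

text \<open>Fixes the sign convention: \<open>shift_cfg v\<close> undoes a translation of the minus
  set by \<open>v\<close>, so preimages under \<open>shift_cfg v\<close> go with translates by
  \<open>+v\<close>.\<close>

lemma shift_cfg_of: "shift_cfg v (cfg_of (translate v ` M)) = cfg_of M"
  using inj_translate[of v] by (auto simp: fun_eq_iff shift_cfg_translate cfg_of_def inj_image_mem_iff)

lemma shift_vimage_all_plus: "shift_cfg v -` all_plus U = all_plus (translate v ` U)"
  by (auto simp: all_plus_def shift_cfg_translate)

lemma fv_translate: "fv (translate v ` I) (shift_cfg v -` A) = fv I A"
proof -
  have inj: "inj_on ((`) (translate v)) X" for X
    using inj_image_eq_iff[OF inj_translate] by (auto simp: inj_on_def)
  have 1: "Pow (translate v ` I) = (`) (translate v) ` Pow I"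
    by (auto simp: subset_image_iff)
  have 2: "Pow (translate v ` I) \<inter> {M. cfg_of M \<in> shift_cfg v -` A}
    = (`) (translate v) ` (Pow I \<inter> {M. cfg_of M \<in> A})"
    unfolding 1 by (auto simp: shift_cfg_of)
  show ?thesis
    unfolding fv_def 2 unfolding Zsum_def 1 by (simp add: sum.reindex[OF inj] wt_translate)
qed

section \<open>The thermodynamic limit\<close>

definition depends_on :: "face set \<Rightarrow> (face \<Rightarrow> bool) set \<Rightarrow> bool" where
  "depends_on S A \<longleftrightarrow> (\<forall>\<omega> \<omega>'. (\<forall>x\<in>S. \<omega> x = \<omega>' x) \<longrightarrow> (\<omega> \<in> A \<longleftrightarrow> \<omega>' \<in> A))"

lemma cylinder_event_iff: "cylinder_event A \<longleftrightarrow> (\<exists>S. finite S \<and> depends_on S A)"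
  by (simp add: cylinder_event_def depends_on_def)

lemma depends_on_Int: "depends_on S A \<Longrightarrow> depends_on T B \<Longrightarrow> depends_on (S \<union> T) (A \<inter> B)"
  unfolding depends_on_def by simp blast

lemma cylinder_Int: "cylinder_event A \<Longrightarrow> cylinder_event B \<Longrightarrow> cylinder_event (A \<inter> B)"
  unfolding cylinder_event_iff by (meson depends_on_Int finite_UnI)

lemma cylinder_all_plus: "finite U \<Longrightarrow> cylinder_event (all_plus U)"
  unfolding cylinder_event_iff depends_on_def all_plus_def by auto

lemma cylinder_shift:
  assumes "cylinder_event A"
  shows "cylinder_event (shift_cfg v -` A)"
proof -
  obtain S where S: "finite S" "depends_on S A" using assms by (auto simp: cylinder_event_iff)
  have "depends_on (translate v ` S) (shift_cfg v -` A)"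
    unfolding depends_on_def vimage_eq
  proof (intro allI impI)
    fix \<omega> \<omega>' :: "face \<Rightarrow> bool" assume "\<forall>x\<in>translate v ` S. \<omega> x = \<omega>' x"
    then have "\<forall>x\<in>S. shift_cfg v \<omega> x = shift_cfg v \<omega>' x" by (simp add: shift_cfg_translate)
    then show "shift_cfg v \<omega> \<in> A \<longleftrightarrow> shift_cfg v \<omega>' \<in> A" using S by (simp add: depends_on_def)
  qed
  then show ?thesis using S cylinder_event_iff by blast
qed

text \<open>Moebius inversion, one face at a time. With \<open>?A s\<close> the section of
  \<open>A\<close> at spin \<open>s\<close> of \<open>x\<close>, the indicator of \<open>A\<close>
  is that of \<open>?A False\<close>, plus the difference of the two sections where \<open>x\<close>
  is plus.\<close>

lemma indicator_all_plus_expansion: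
  assumes "finite S" "depends_on S A"
  shows "\<exists>c. \<forall>\<omega>. indicat_real A \<omega> = (\<Sum>U\<in>Pow S. c U * indicat_real (all_plus U) \<omega>)"
  using assms
proof (induction S arbitrary: A rule: finite_induct)
  case empty
  then have "A = {} \<or> A = UNIV" by (auto simp: depends_on_def)
  then obtain a :: real where "\<forall>\<omega>. indicat_real A \<omega> = a" by (metis indicator_simps UNIV_I empty_iff)
  then show ?case by (auto simp: all_plus_def intro!: exI[of _ "\<lambda>_. a"])
next
  case (insert x S)
  let ?A = "\<lambda>s. {\<tau>. \<tau>(x := s) \<in> A}"
  have dep: "depends_on S (?A s)" for s
    unfolding depends_on_def
  proof (intro allI impI)
    fix \<tau> \<tau>' :: "face \<Rightarrow> bool" assume "\<forall>y\<in>S. \<tau> y = \<tau>' y"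
    then have "\<forall>y\<in>insert x S. (\<tau>(x := s)) y = (\<tau>'(x := s)) y" by simp
    then show "\<tau> \<in> ?A s \<longleftrightarrow> \<tau>' \<in> ?A s" using insert.prems unfolding depends_on_def by blast
  qed
  obtain c where c: "\<And>s \<tau>. indicat_real (?A s) \<tau> = (\<Sum>U\<in>Pow S. c s U * indicat_real (all_plus U) \<tau>)"
    using insert.IH[OF dep] by metis
  \<comment> \<open>Sets containing \<open>x\<close> collect the difference of the two sections, the
    other sets the section at minus.\<close>
  define d where "d U = (if x \<in> U then c True (U - {x}) - c False (U - {x}) else c False U)" for U
  have "indicat_real A \<tau> = (\<Sum>U\<in>Pow (insert x S). d U * indicat_real (all_plus U) \<tau>)" for \<tau>
  proof -
    have "(\<Sum>U\<in>Pow (insert x S). d U * indicat_real (all_plus U) \<tau>) =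
      (\<Sum>U\<in>Pow S. c False U * indicat_real (all_plus U) \<tau> +
        (if \<tau> x then c True U - c False U else 0) * indicat_real (all_plus U) \<tau>)"
      unfolding sum_Pow_insert[OF insert.hyps]
    proof (rule sum.cong[OF refl])
      fix U assume "U \<in> Pow S"
      then have "x \<notin> U" "insert x U - {x} = U" using insert.hyps by auto
      then show "d U * indicat_real (all_plus U) \<tau> + d (insert x U) * indicat_real (all_plus (insert x U)) \<tau> =
        c False U * indicat_real (all_plus U) \<tau> +
        (if \<tau> x then c True U - c False U else 0) * indicat_real (all_plus U) \<tau>"
        by (auto simp: d_def all_plus_def indicator_def)
    qed
    also have "\<dots> = (\<Sum>U\<in>Pow S. c (\<tau> x) U * indicat_real (all_plus U) \<tau>)"
      by (rule sum.cong) (auto simp: algebra_simps)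
    also have "\<dots> = indicat_real (?A (\<tau> x)) \<tau>" by (simp add: c)
    also have "\<dots> = indicat_real A \<tau>" by (simp add: indicator_def)
    finally show ?thesis by simp
  qed
  then show ?case by blast
qed

lemma cylinder_expansion:
  assumes "cylinder_event A"
  obtains S c where "finite S" "\<And>\<omega>. indicat_real A \<omega> = (\<Sum>U\<in>Pow S. c U * indicat_real (all_plus U) \<omega>)"
  using assms indicator_all_plus_expansion unfolding cylinder_event_iff by metis

section \<open>Limits along the directed set of finite face sets\<close>

abbreviation fin_sets :: "face set filter" where
  "fin_sets \<equiv> finite_subsets_at_top UNIV"

text \<open>A genuine limit for cylinder events, by \<open>fv_tendsto\<close>.\<close>

definition lv :: "(face \<Rightarrow> bool) set \<Rightarrow> real" where
  "lv A = Lim fin_sets (\<lambda>I. fv I A)"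

lemma eventually_fin_sets: "finite X \<Longrightarrow> eventually (\<lambda>I. finite I \<and> X \<subseteq> I) fin_sets"
  by (auto simp: eventually_finite_subsets_at_top)

lemma eventually_finite_fin_sets: "eventually finite fin_sets"
  by (auto simp: eventually_finite_subsets_at_top)

lemma fv_tendsto_increasing:
  assumes "increasing_event A"
  shows "((\<lambda>I. fv I A) \<longlongrightarrow> (INF I\<in>Collect finite. fv I A)) fin_sets"
proof (rule decreasing_tendsto)
  let ?m = "INF I\<in>Collect finite. fv I A"
  have bdd: "bdd_below ((\<lambda>I. fv I A) ` Collect finite)" by (rule bdd_belowI[of _ 0]) (auto simp: fv_nonneg)
  show "\<forall>\<^sub>F I in fin_sets. ?m \<le> fv I A"
    using eventually_finite_fin_sets by eventually_elim (auto intro: cINF_lower[OF bdd])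
  fix x assume "?m < x"
  then obtain J where J: "finite J" "fv J A < x"
    using cINF_less_iff[of "Collect finite", OF _ bdd] by auto
  show "\<forall>\<^sub>F I in fin_sets. fv I A < x"
    using eventually_fin_sets[OF J(1)]
  proof eventually_elim
    case (elim I)
    then have "fv I A \<le> fv J A" by (intro fv_antimono assms) auto
    then show ?case using J(2) by simp
  qed
qed

lemma fv_expansion:
  assumes "finite I" "\<And>\<omega>. indicat_real A \<omega> = (\<Sum>U\<in>Pow S. c U * indicat_real (all_plus U) \<omega>)"
  shows "fv I A = (\<Sum>U\<in>Pow S. c U * fv I (all_plus U))"
proof -
  have "(\<Sum>M\<in>Pow I. wt M * indicat_real A (cfg_of M)) =
    (\<Sum>M\<in>Pow I. \<Sum>U\<in>Pow S. c U * (wt M * indicat_real (all_plus U) (cfg_of M)))"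
    unfolding assms(2) by (simp add: sum_distrib_left mult_ac)
  also have "\<dots> = (\<Sum>U\<in>Pow S. \<Sum>M\<in>Pow I. c U * (wt M * indicat_real (all_plus U) (cfg_of M)))"
    by (rule sum.swap)
  finally show ?thesis
    unfolding fv_eq_sum[OF assms(1)] by (simp only: sum_distrib_left sum_divide_distrib times_divide_eq_right)
qed

text \<open>Monotonicity gives the limit for increasing events only; a general cylinder event is a
  finite signed combination of those.\<close>

lemma fv_tendsto:
  assumes "cylinder_event A"
  shows "((\<lambda>I. fv I A) \<longlongrightarrow> lv A) fin_sets"
proof -
  obtain S c where S: "finite S" and c: "\<And>\<omega>. indicat_real A \<omega> = (\<Sum>U\<in>Pow S. c U * indicat_real (all_plus U) \<omega>)"
    using cylinder_expansion[OF assms] by blast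
  let ?l = "\<Sum>U\<in>Pow S. c U * (INF I\<in>Collect finite. fv I (all_plus U))"
  have "((\<lambda>I. \<Sum>U\<in>Pow S. c U * fv I (all_plus U)) \<longlongrightarrow> ?l) fin_sets"
    by (intro tendsto_sum tendsto_mult_left fv_tendsto_increasing increasing_all_plus)
  moreover have "\<forall>\<^sub>F I in fin_sets. (\<Sum>U\<in>Pow S. c U * fv I (all_plus U)) = fv I A"
    using eventually_finite_fin_sets by eventually_elim (simp add: fv_expansion[OF _ c])
  ultimately have "((\<lambda>I. fv I A) \<longlongrightarrow> ?l) fin_sets" by (rule Lim_transform_eventually)
  then show ?thesis unfolding lv_def by (simp add: tendsto_Lim[OF finite_subsets_at_top_neq_bot])
qed

lemma lv_unique:
  assumes "cylinder_event A" "((\<lambda>I. fv I A) \<longlongrightarrow> l) fin_sets"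
  shows "lv A = l"
  using tendsto_unique[OF finite_subsets_at_top_neq_bot fv_tendsto[OF assms(1)] assms(2)] .

lemma lv_nonneg: "cylinder_event A \<Longrightarrow> 0 \<le> lv A"
  by (rule tendsto_lowerbound[OF fv_tendsto]) (simp_all add: fv_nonneg finite_subsets_at_top_neq_bot)

lemma cylinder_UNIV: "cylinder_event UNIV"
  by (auto simp: cylinder_event_def)

lemma lv_UNIV: "lv UNIV = 1"
proof (rule lv_unique[OF cylinder_UNIV])
  have "\<forall>\<^sub>F I in fin_sets. 1 = fv I UNIV"
    using eventually_finite_fin_sets by eventually_elim (simp add: fv_UNIV)
  then show "((\<lambda>I. fv I UNIV) \<longlongrightarrow> 1) fin_sets" by (rule Lim_transform_eventually[OF tendsto_const])
qed

lemma lv_sum_disjoint: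
  assumes "finite K" "\<And>k. k \<in> K \<Longrightarrow> cylinder_event (A k)" "disjoint_family_on A K"
    and "cylinder_event (\<Union>k\<in>K. A k)"
  shows "lv (\<Union>k\<in>K. A k) = (\<Sum>k\<in>K. lv (A k))"
proof (rule lv_unique[OF assms(4)])
  have "((\<lambda>I. \<Sum>k\<in>K. fv I (A k)) \<longlongrightarrow> (\<Sum>k\<in>K. lv (A k))) fin_sets"
    using assms by (intro tendsto_sum fv_tendsto) auto
  moreover have "(\<Sum>k\<in>K. fv I (A k)) = fv I (\<Union>k\<in>K. A k)" if "finite I" for I
  proof -
    have "(\<Sum>k\<in>K. wt M * indicat_real (A k) (cfg_of M)) = wt M * indicat_real (\<Union>k\<in>K. A k) (cfg_of M)" for M
      by (simp add: indicator_UN_disjoint[OF assms(1,3)] sum_distrib_left)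
    then have "(\<Sum>M\<in>Pow I. \<Sum>k\<in>K. wt M * indicat_real (A k) (cfg_of M))
        = (\<Sum>M\<in>Pow I. wt M * indicat_real (\<Union>k\<in>K. A k) (cfg_of M))"
      by simp
    then show ?thesis
      using that by (simp add: fv_eq_sum sum_divide_distrib[symmetric] sum.swap[of _ K])
  qed
  then have "\<forall>\<^sub>F I in fin_sets. (\<Sum>k\<in>K. fv I (A k)) = fv I (\<Union>k\<in>K. A k)"
    by (rule eventually_mono[OF eventually_finite_fin_sets])
  ultimately show "((\<lambda>I. fv I (\<Union>k\<in>K. A k)) \<longlongrightarrow> (\<Sum>k\<in>K. lv (A k))) fin_sets"
    by (rule Lim_transform_eventually)
qed

lemma lv_FKG:
  assumes "cylinder_event A" "cylinder_event B" "increasing_event A" "increasing_event B"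
  shows "lv A * lv B \<le> lv (A \<inter> B)"
proof (rule tendsto_le[OF finite_subsets_at_top_neq_bot])
  show "((\<lambda>I. fv I (A \<inter> B)) \<longlongrightarrow> lv (A \<inter> B)) fin_sets" by (intro fv_tendsto cylinder_Int assms)
  show "((\<lambda>I. fv I A * fv I B) \<longlongrightarrow> lv A * lv B) fin_sets" by (intro tendsto_mult fv_tendsto assms)
  show "\<forall>\<^sub>F I in fin_sets. fv I A * fv I B \<le> fv I (A \<inter> B)"
    using eventually_finite_fin_sets by eventually_elim (simp add: fv_FKG assms)
qed

lemma lv_le_fv:
  assumes "cylinder_event A" "increasing_event A" "finite J"
  shows "lv A \<le> fv J A"
proof (rule tendsto_upperbound[OF fv_tendsto[OF assms(1)]])
  show "\<forall>\<^sub>F I in fin_sets. fv I A \<le> fv J A"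
    using eventually_fin_sets[OF assms(3)] by eventually_elim (use fv_antimono assms in auto)
qed (rule finite_subsets_at_top_neq_bot)

lemma filterlim_translate_fin_sets: "filterlim (\<lambda>I. translate v ` I) fin_sets fin_sets"
  unfolding filterlim_def le_filter_def eventually_filtermap
proof (intro allI impI)
  fix Q assume "eventually Q fin_sets"
  then obtain X where X: "finite X" "\<And>Y. finite Y \<Longrightarrow> X \<subseteq> Y \<Longrightarrow> Q Y"
    by (auto simp: eventually_finite_subsets_at_top)
  have "finite (translate (- v) ` X)" using X by simp
  from eventually_fin_sets[OF this] show "\<forall>\<^sub>F I in fin_sets. Q (translate v ` I)"
  proof eventually_elim
    case (elim I)
    have "X = translate v ` translate (- v) ` X" by (simp add: image_image translate_translate)
    also have "\<dots> \<subseteq> translate v ` I" using elim by blast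
    finally show ?case using elim X by blast
  qed
qed

text \<open>Moving set and event together does not change \<open>fv\<close>, and translation only
  reindexes the directed set of finite sets, so both sides are limits of the same net.\<close>

lemma lv_shift:
  assumes "cylinder_event A"
  shows "lv (shift_cfg v -` A) = lv A"
proof (rule tendsto_unique[OF finite_subsets_at_top_neq_bot])
  show "((\<lambda>I. fv I A) \<longlongrightarrow> lv A) fin_sets" by (rule fv_tendsto[OF assms])
  have "((\<lambda>I. fv (translate v ` I) (shift_cfg v -` A)) \<longlongrightarrow> lv (shift_cfg v -` A)) fin_sets"
    by (rule filterlim_compose[OF fv_tendsto[OF cylinder_shift[OF assms]] filterlim_translate_fin_sets])
  then show "((\<lambda>I. fv I A) \<longlongrightarrow> lv (shift_cfg v -` A)) fin_sets" by (simp add: fv_translate)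
qed

text \<open>The lower bound is FKG. For the upper bound, fill everything outside two distant translates of a
  large finite set with pluses, which only increases the probability and makes the two events independent.\<close>

lemma lv_all_plus_mixing:
  assumes "finite U" "finite V"
  shows "(\<lambda>n. lv (all_plus (U \<union> translate (int n, 0) ` V))) \<longlonglongrightarrow> lv (all_plus U) * lv (all_plus V)"
proof (rule tendstoI)
  fix \<epsilon> :: real assume "\<epsilon> > 0"
  let ?l = "lv (all_plus U) * lv (all_plus V)"
  have "((\<lambda>I. fv I (all_plus U) * fv I (all_plus V)) \<longlongrightarrow> ?l) fin_sets"
    using assms by (intro tendsto_mult fv_tendsto cylinder_all_plus)
  then have "\<forall>\<^sub>F I in fin_sets. fv I (all_plus U) * fv I (all_plus V) < ?l + \<epsilon>"
    using \<open>\<epsilon> > 0\<close> by (intro order_tendstoD) auto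
  moreover have "\<forall>\<^sub>F I in fin_sets. finite I \<and> U \<union> V \<subseteq> I" using assms by (intro eventually_fin_sets) auto
  ultimately have "\<forall>\<^sub>F I in fin_sets. fv I (all_plus U) * fv I (all_plus V) < ?l + \<epsilon> \<and> finite I \<and> U \<union> V \<subseteq> I"
    by eventually_elim simp
  \<comment> \<open>A single finite set at which the product is already below the limit plus
    \<epsilon>; it is used twice below, once translated.\<close>
  then obtain I where I: "fv I (all_plus U) * fv I (all_plus V) < ?l + \<epsilon>" "finite I" "U \<union> V \<subseteq> I"
    using eventually_happens'[OF finite_subsets_at_top_neq_bot] by blast
  obtain k :: nat where k: "nbh I \<subseteq> box (int k)" using finite_subset_box[of "nbh I"] I by auto
  \<comment> \<open>A horizontal shift by more than \<open>2 * k\<close> moves a box of radius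
    \<open>k\<close> off itself.\<close>
  have "dist (lv (all_plus (U \<union> translate (int n, 0) ` V))) ?l < \<epsilon>" if n: "n > 2 * k" for n
  proof -
    let ?t = "translate (int n, 0)"
    have "translate (int n, 0) f \<notin> box (int k)" if "f \<in> box (int k)" for f
      using that n by (auto simp: box_def translate_def)
    then have disj: "nbh I \<inter> nbh (?t ` I) = {}" using k unfolding nbh_translate by blast
    have "lv (all_plus (U \<union> ?t ` V)) \<le> fv (I \<union> ?t ` I) (all_plus (U \<union> ?t ` V))"
      using assms I by (intro lv_le_fv cylinder_all_plus increasing_all_plus) auto
    also have "\<dots> = fv I (all_plus U) * fv (?t ` I) (all_plus (?t ` V))"
      using I disj by (intro fv_all_plus_Un) auto
    also have "fv (?t ` I) (all_plus (?t ` V)) = fv I (all_plus V)"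
      by (simp add: fv_translate flip: shift_vimage_all_plus)
    finally have "lv (all_plus (U \<union> ?t ` V)) < ?l + \<epsilon>" using I by simp
    moreover have "lv (all_plus (?t ` V)) = lv (all_plus V)"
      using assms by (simp add: lv_shift cylinder_all_plus flip: shift_vimage_all_plus)
    then have "?l \<le> lv (all_plus (U \<union> ?t ` V))"
      using lv_FKG[of "all_plus U" "all_plus (?t ` V)"] assms
      by (simp add: all_plus_Un cylinder_all_plus increasing_all_plus)
    ultimately show ?thesis using \<open>\<epsilon> > 0\<close> by (simp add: dist_real_def)
  qed
  then show "\<forall>\<^sub>F n in sequentially. dist (lv (all_plus (U \<union> translate (int n, 0) ` V))) ?l < \<epsilon>"
    using eventually_gt_at_top[of "2 * k"] by (rule eventually_mono[rotated])
qed

section \<open>Geometry of the hexagonal lattice\<close>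

text \<open>Real coordinates in the basis 1, \<open>omega\<close>. Face centres become integer
  points and vertices of H have coordinates in thirds, so intersections of edges become integer
  arithmetic.\<close>

definition lattice_pt :: "real \<Rightarrow> real \<Rightarrow> complex" where
  "lattice_pt s t = of_real s + of_real t * omega"

lemma Re_omega: "Re omega = 1 / 2" and Im_omega: "Im omega = sqrt 3 / 2"
  by (simp_all add: omega_def cos_60 sin_60)

lemma Im_lattice_pt: "Im (lattice_pt s t) = t * (sqrt 3 / 2)"
  and Re_lattice_pt: "Re (lattice_pt s t) = s + t / 2"
  by (simp_all add: lattice_pt_def Re_omega Im_omega)

lemma lattice_pt_eq_iff: "lattice_pt s t = lattice_pt s' t' \<longleftrightarrow> s = s' \<and> t = t'"
  by (auto simp: complex_eq_iff Im_lattice_pt Re_lattice_pt)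

lemma hpos_eq: "hpos (a, b, up) =
    lattice_pt (of_int a + (if up then 1 else 2) / 3) (of_int b + (if up then 1 else 2) / 3)"
  by (simp add: hpos_def face_centre_def lattice_pt_def complex_eq_iff field_simps)

lemma edge_pts_pair: "edge_pts {u, v} = closed_segment (hpos u) (hpos v)"
proof -
  have "\<Union>{closed_segment (hpos u') (hpos v') | u' v'. {u, v} = {u', v'}} = closed_segment (hpos u) (hpos v)"
    using closed_segment_commute by (fastforce simp: doubleton_eq_iff)
  then show ?thesis by (simp add: edge_pts_def)
qed

lemma edge_open_pts_pair: "edge_open_pts {u, v} = open_segment (hpos u) (hpos v)"
proof -
  have "\<Union>{open_segment (hpos u') (hpos v') | u' v'. {u, v} = {u', v'}} = open_segment (hpos u) (hpos v)"
    using open_segment_commute by (fastforce simp: doubleton_eq_iff)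
  then show ?thesis by (simp add: edge_open_pts_def)
qed

lemma lattice_pt_segment:
  assumes "z \<in> closed_segment (lattice_pt s t) (lattice_pt s' t')"
  obtains l where "0 \<le> l" "l \<le> 1" "z = lattice_pt (s + l * (s' - s)) (t + l * (t' - t))"
proof -
  from assms obtain l where "0 \<le> l" "l \<le> 1" "z = (1 - l) *\<^sub>R lattice_pt s t + l *\<^sub>R lattice_pt s' t'"
    by (auto simp: in_segment)
  moreover have "(1 - l) *\<^sub>R lattice_pt s t + l *\<^sub>R lattice_pt s' t' = lattice_pt (s + l * (s' - s)) (t + l * (t' - t))"
    by (simp add: complex_eq_iff Re_lattice_pt Im_lattice_pt field_simps)
  ultimately show thesis using that by blast
qed

text \<open>The parameter \<open>l\<close> runs from the up-triangle end (\<open>l = 0\<close>) to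
  the down-triangle end (\<open>l = 1\<close>).\<close>

lemma edge_pts_cases:
  assumes "e \<in> hex_edges" "z \<in> edge_pts e"
  obtains (diag) a b l where "0 \<le> l" "l \<le> 1" "e = {(a, b, True), (a, b, False)}"
      "z = lattice_pt (of_int a + 1 / 3 + l / 3) (of_int b + 1 / 3 + l / 3)"
  | (down) a b l where "0 \<le> l" "l \<le> 1" "e = {(a, b, True), (a, b - 1, False)}"
      "z = lattice_pt (of_int a + 1 / 3 + l / 3) (of_int b + 1 / 3 - 2 * l / 3)"
  | (left) a b l where "0 \<le> l" "l \<le> 1" "e = {(a, b, True), (a - 1, b, False)}"
      "z = lattice_pt (of_int a + 1 / 3 - 2 * l / 3) (of_int b + 1 / 3 + l / 3)"
  using assms(1)
proof (cases rule: hex_edges_cases)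
  case (1 a b)
  with assms have "z \<in> closed_segment (lattice_pt (of_int a + 1 / 3) (of_int b + 1 / 3)) (lattice_pt (of_int a + 2 / 3) (of_int b + 2 / 3))"
    by (simp add: edge_pts_pair hpos_eq)
  then obtain l where l: "0 \<le> l" "l \<le> 1"
    "z = lattice_pt (of_int a + 1 / 3 + l * (of_int a + 2 / 3 - (of_int a + 1 / 3))) (of_int b + 1 / 3 + l * (of_int b + 2 / 3 - (of_int b + 1 / 3)))"
    by (rule lattice_pt_segment)
  show thesis by (rule diag[OF l(1,2) 1]) (simp add: l(3) lattice_pt_eq_iff field_simps)
next
  case (2 a b)
  with assms have "z \<in> closed_segment (lattice_pt (of_int a + 1 / 3) (of_int b + 1 / 3)) (lattice_pt (of_int a + 2 / 3) (of_int b - 1 / 3))"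
    by (simp add: edge_pts_pair hpos_eq)
  then obtain l where l: "0 \<le> l" "l \<le> 1"
    "z = lattice_pt (of_int a + 1 / 3 + l * (of_int a + 2 / 3 - (of_int a + 1 / 3))) (of_int b + 1 / 3 + l * (of_int b - 1 / 3 - (of_int b + 1 / 3)))"
    by (rule lattice_pt_segment)
  show thesis by (rule down[OF l(1,2) 2]) (simp add: l(3) lattice_pt_eq_iff field_simps)
next
  case (3 a b)
  with assms have "z \<in> closed_segment (lattice_pt (of_int a + 1 / 3) (of_int b + 1 / 3)) (lattice_pt (of_int a - 1 / 3) (of_int b + 2 / 3))"
    by (simp add: edge_pts_pair hpos_eq)
  then obtain l where l: "0 \<le> l" "l \<le> 1"
    "z = lattice_pt (of_int a + 1 / 3 + l * (of_int a - 1 / 3 - (of_int a + 1 / 3))) (of_int b + 1 / 3 + l * (of_int b + 2 / 3 - (of_int b + 1 / 3)))"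
    by (rule lattice_pt_segment)
  show thesis by (rule left[OF l(1,2) 3]) (simp add: l(3) lattice_pt_eq_iff field_simps)
qed

text \<open>The fractional parts lie between 0 and 1/3, so the integers differ by less than
  1.\<close>

lemma diag_diag:
  fixes a b a' b' :: int and l l' :: real
  assumes "0 \<le> l" "l \<le> 1" "0 \<le> l'" "l' \<le> 1" "of_int a + l / 3 = of_int a' + l' / 3"
  shows "a = a'" "l = l'"
proof -
  have "a < a' + 1" "a' < a + 1" using assms by linarith+
  then have a: "a = a'" by simp
  show "a = a'" by (rule a)
  show "l = l'" using assms(5) unfolding a by simp
qed

text \<open>The drawing is planar. For edges of different directions the two coordinate equations
  force an integer combination of the parameters, which leaves only their endpoints.\<close>

lemma edges_meet:
  assumes "e \<in> hex_edges" "e' \<in> hex_edges" "e \<noteq> e'" "z \<in> edge_pts e" "z \<in> edge_pts e'"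
  shows "e \<inter> e' \<noteq> {}"
proof -
  have dd: "{(a, b, True), (a, b, False)} \<inter> {(a', b', True), (a', b' - 1, False)} \<noteq> {}"
    if "0 \<le> l" "l \<le> 1" "0 \<le> l'" "l' \<le> 1"
      "lattice_pt (of_int a + 1 / 3 + l / 3) (of_int b + 1 / 3 + l / 3) =
       lattice_pt (of_int a' + 1 / 3 + l' / 3) (of_int b' + 1 / 3 - 2 * l' / 3)" for a b a' b' :: int and l l' :: real
  proof -
    have eq: "of_int a + l / 3 = of_int a' + l' / 3"
      "of_int b + l / 3 = of_int b' - 2 * l' / 3"
      using that(5) by (auto simp: lattice_pt_eq_iff)
    note * = diag_diag[OF that(1-4) eq(1)]
    \<comment> \<open>An integer in the unit interval: the common point is the up-triangle end for 0
      and the down-triangle end for 1.\<close>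
    then have "of_int (b' - b) = l" using eq(2) by simp
    then have "b' - b = 0 \<or> b' - b = 1" using that by linarith
    then show ?thesis using * by auto
  qed
  have dl: "{(a, b, True), (a, b, False)} \<inter> {(a', b', True), (a' - 1, b', False)} \<noteq> {}"
    if "0 \<le> l" "l \<le> 1" "0 \<le> l'" "l' \<le> 1"
      "lattice_pt (of_int a + 1 / 3 + l / 3) (of_int b + 1 / 3 + l / 3) =
       lattice_pt (of_int a' + 1 / 3 - 2 * l' / 3) (of_int b' + 1 / 3 + l' / 3)" for a b a' b' :: int and l l' :: real
  proof -
    have eq: "of_int b + l / 3 = of_int b' + l' / 3" "of_int a + l / 3 = of_int a' - 2 * l' / 3"
      using that(5) by (auto simp: lattice_pt_eq_iff)
    note * = diag_diag[OF that(1-4) eq(1)]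
    then have "of_int (a' - a) = l" using eq(2) by simp
    then have "a' - a = 0 \<or> a' - a = 1" using that by linarith
    then show ?thesis using * by auto
  qed
  have wl: "{(a, b, True), (a, b - 1, False)} \<inter> {(a', b', True), (a' - 1, b', False)} \<noteq> {}"
    if "0 \<le> l" "l \<le> 1" "0 \<le> l'" "l' \<le> 1"
      "lattice_pt (of_int a + 1 / 3 + l / 3) (of_int b + 1 / 3 - 2 * l / 3) =
       lattice_pt (of_int a' + 1 / 3 - 2 * l' / 3) (of_int b' + 1 / 3 + l' / 3)" for a b a' b' :: int and l l' :: real
  proof -
    \<comment> \<open>Both right sides lie between 0 and 1, and each vanishes exactly when
      \<open>l = l' = 0\<close>. So both are 0, with a common up vertex, or both are 1, with a
      common down vertex.\<close>
    have eq: "of_int (a' - a) = (l + 2 * l') / 3" "of_int (b - b') = (l' + 2 * l) / 3"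
      using that(5) by (auto simp: lattice_pt_eq_iff field_simps)
    have "0 \<le> real_of_int (a' - a)" "real_of_int (a' - a) \<le> 1" "0 \<le> real_of_int (b - b')" "real_of_int (b - b') \<le> 1"
      unfolding eq using that(1-4) by simp_all
    then have "a' - a = 0 \<or> a' - a = 1" "b - b' = 0 \<or> b - b' = 1" by auto
    moreover have "a' - a = 0 \<longleftrightarrow> b - b' = 0"
    proof
      assume "a' - a = 0"
      then have "l = 0" "l' = 0" using eq(1) that by auto
      then show "b - b' = 0" using eq(2) by simp
    next
      assume "b - b' = 0"
      then have "l = 0" "l' = 0" using eq(2) that by auto
      then show "a' - a = 0" using eq(1) by simp
    qed
    ultimately have "(a' = a \<and> b' = b) \<or> (a' = a + 1 \<and> b' = b - 1)" by linarith
    then show ?thesis by auto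
  qed
  from assms(1,4) show ?thesis
  proof (cases rule: edge_pts_cases)
    case E: (diag a b l)
    from assms(2,5) show ?thesis
    proof (cases rule: edge_pts_cases)
      case E': (diag a' b' l')
      then have "a = a'" "b = b'" using E diag_diag[of l l' a a'] diag_diag[of l l' b b'] by (auto simp: lattice_pt_eq_iff)
      then show ?thesis using E E' by simp
    next
      case E': (down a' b' l')
      show ?thesis unfolding E(3) E'(3) by (rule dd[of l l']) (use E E' in simp_all)
    next
      case E': (left a' b' l')
      show ?thesis unfolding E(3) E'(3) by (rule dl[of l l']) (use E E' in simp_all)
    qed
  next
    case E: (down a b l)
    from assms(2,5) show ?thesis
    proof (cases rule: edge_pts_cases)
      case E': (diag a' b' l')
      show ?thesis unfolding E(3) E'(3) Int_commute[of "{(a, b, True), (a, b - 1, False)}"]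
        by (rule dd[of l' l]) (use E E' in simp_all)
    next
      case E': (down a' b' l')
      then have eq: "of_int a + l / 3 = of_int a' + l' / 3" "of_int b - 2 * l / 3 = of_int b' - 2 * l' / 3"
        using E by (auto simp: lattice_pt_eq_iff)
      have "a = a'" "l = l'" using diag_diag[OF E(1,2) E'(1,2) eq(1)] by auto
      then show ?thesis using E E' eq(2) by simp
    next
      case E': (left a' b' l')
      show ?thesis unfolding E(3) E'(3) by (rule wl[of l l']) (use E E' in simp_all)
    qed
  next
    case E: (left a b l)
    from assms(2,5) show ?thesis
    proof (cases rule: edge_pts_cases)
      case E': (diag a' b' l')
      show ?thesis unfolding E(3) E'(3) Int_commute[of "{(a, b, True), (a - 1, b, False)}"]
        by (rule dl[of l' l]) (use E E' in simp_all)
    next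
      case E': (down a' b' l')
      show ?thesis unfolding E(3) E'(3) Int_commute[of "{(a, b, True), (a - 1, b, False)}"]
        by (rule wl[of l' l]) (use E E' in simp_all)
    next
      case E': (left a' b' l')
      then have eq: "of_int b + l / 3 = of_int b' + l' / 3" "of_int a - 2 * l / 3 = of_int a' - 2 * l' / 3"
        using E by (auto simp: lattice_pt_eq_iff)
      have "b = b'" "l = l'" using diag_diag[OF E(1,2) E'(1,2) eq(1)] by auto
      then show ?thesis using E E' eq(2) by simp
    qed
  qed
qed

section \<open>Polygons and the faces they enclose\<close>

lemma sap_subset: "is_sap P \<Longrightarrow> P \<subseteq> hex_edges" and sap_finite: "is_sap P \<Longrightarrow> finite P"
  by (auto simp: is_sap_def)

text \<open>Every vertex on the polygon carries a second polygon edge, so the polygon cannot merely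
  end at a corner of a face.\<close>

lemma sap_degree:
  assumes "is_sap P" "e \<in> P" "w \<in> e"
  obtains e' where "e' \<in> P" "e' \<noteq> e" "w \<in> e'"
proof -
  from assms(1) obtain vs where vs: "distinct vs" "length vs \<ge> 3"
    and P: "P = {{vs ! i, vs ! ((i + 1) mod length vs)} | i. i < length vs}"
    by (auto simp: is_sap_def)
  let ?n = "length vs"
  let ?E = "\<lambda>i. {vs ! i, vs ! ((i + 1) mod ?n)}"
  have EP: "?E i \<in> P" if "i < ?n" for i using that P by blast
  have lt: "i mod ?n < ?n" for i using vs by (intro mod_less_divisor) auto
  \<comment> \<open>Here at least three vertices are needed: with two, the consecutive edges of the
    cycle would coincide.\<close>
  have ne: "?E i \<noteq> ?E ((i + 1) mod ?n)" if i: "i < ?n" for i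
  proof
    assume "?E i = ?E ((i + 1) mod ?n)"
    then have "vs ! i = vs ! ((i + 1) mod ?n) \<or> vs ! i = vs ! (((i + 1) mod ?n + 1) mod ?n)"
      by (auto simp: doubleton_eq_iff)
    then have "i = (i + 1) mod ?n \<or> i = ((i + 1) mod ?n + 1) mod ?n"
      using vs(1) i lt by (simp add: nth_eq_iff_index_eq)
    moreover have m: "(k + 1) mod ?n = (if k + 1 = ?n then 0 else k + 1)" if "k < ?n" for k using that by auto
    define k where "k = (i + 1) mod ?n"
    have "k < ?n" unfolding k_def by (rule lt)
    ultimately have "i = k \<or> i = (if k + 1 = ?n then 0 else k + 1)" unfolding k_def[symmetric] by (metis m)
    moreover have "k = (if i + 1 = ?n then 0 else i + 1)" unfolding k_def by (rule m[OF i])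
    ultimately show False using i vs(2) by (simp split: if_splits)
  qed
  from assms(2) obtain i where i: "i < ?n" "e = ?E i" using P by auto
  from assms(3) i consider "w = vs ! i" | "w = vs ! ((i + 1) mod ?n)" by auto
  then show thesis
  proof cases
    case 1
    let ?j = "if i = 0 then ?n - 1 else i - 1"
    have j: "(?j + 1) mod ?n = i" "?j < ?n"
      using i vs(2) by (cases "i = 0"; simp)+
    show thesis
    proof (rule that[OF EP[OF j(2)]])
      show "?E ?j \<noteq> e" using ne[OF j(2)] i unfolding j(1) by simp
      show "w \<in> ?E ?j" unfolding j(1) 1 by simp
    qed
  next
    case 2
    show thesis
    proof (rule that[OF EP[OF lt[of "i + 1"]]])
      show "?E ((i + 1) mod ?n) \<noteq> e" using ne[OF i(1)] i by simp
      show "w \<in> ?E ((i + 1) mod ?n)" unfolding 2 by simp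
    qed
  qed
qed

lemma hex_edge_at_up: "e \<in> hex_edges \<Longrightarrow> (a, b, True) \<in> e \<Longrightarrow>
    e \<in> {{(a, b, True), (a, b, False)}, {(a, b, True), (a, b - 1, False)}, {(a, b, True), (a - 1, b, False)}}"
  by (erule hex_edges_cases) auto

lemma hex_edge_at_down: "e \<in> hex_edges \<Longrightarrow> (a, b, False) \<in> e \<Longrightarrow>
    e \<in> {{(a, b, True), (a, b, False)}, {(a, b + 1, True), (a, b, False)}, {(a + 1, b, True), (a, b, False)}}"
  by (erule hex_edges_cases) auto

text \<open>Three edges meet at \<open>w\<close>, and two of them border any given face having
  \<open>w\<close> as a corner.\<close>

lemma non_bordering_edge_unique:
  assumes "f \<in> corners w" "e \<in> hex_edges" "e' \<in> hex_edges" "w \<in> e" "w \<in> e'"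
    and "\<not> face_borders f e" "\<not> face_borders f e'"
  shows "e = e'"
proof -
  obtain a b up where w: "w = (a, b, up)" by (cases w) auto
  have fb: "face_borders f e \<longleftrightarrow> (\<forall>v\<in>e. f \<in> corners v)" "face_borders f e' \<longleftrightarrow> (\<forall>v\<in>e'. f \<in> corners v)"
    using assms by (auto simp: face_borders_def)
  show ?thesis
  proof (cases up)
    case True
    then have "f \<in> {(a, b), (a + 1, b), (a, b + 1)}" using assms(1) w by (simp add: corners_def)
    moreover have "(a, b, True) \<in> e" "(a, b, True) \<in> e'" using assms w True by auto
    note hex_edge_at_up[OF assms(2) this(1)] hex_edge_at_up[OF assms(3) this(2)]
    ultimately show ?thesis
      using assms(6,7)[unfolded fb] by (elim insertE emptyE) (simp_all add: corners_def)
  next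
    case False
    then have "f \<in> {(a + 1, b), (a, b + 1), (a + 1, b + 1)}" using assms(1) w by (simp add: corners_def)
    moreover have "(a, b, False) \<in> e" "(a, b, False) \<in> e'" using assms w False by auto
    note hex_edge_at_down[OF assms(2) this(1)] hex_edge_at_down[OF assms(3) this(2)]
    ultimately show ?thesis
      using assms(6,7)[unfolded fb] by (elim insertE emptyE) (simp_all add: corners_def)
  qed
qed

text \<open>A meeting point would yield a corner \<open>w\<close> of \<open>f\<close> on the
  polygon, where the polygon has two edges. Neither borders \<open>f\<close>, but only one edge at
  \<open>w\<close> can fail to.\<close>

lemma face_border_avoids_sap:
  assumes P: "is_sap P" and f: "\<And>e. e \<in> P \<Longrightarrow> \<not> face_borders f e" and e: "face_borders f e"
  shows "edge_pts e \<inter> \<Union>(edge_pts ` P) = {}"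
proof (rule ccontr)
  assume "edge_pts e \<inter> \<Union>(edge_pts ` P) \<noteq> {}"
  then obtain z e' where z: "z \<in> edge_pts e" "e' \<in> P" "z \<in> edge_pts e'" by auto
  have he: "e \<in> hex_edges" "e' \<in> hex_edges" "e \<noteq> e'"
    using e z f sap_subset[OF P] by (auto simp: face_borders_def)
  obtain w where w: "w \<in> e" "w \<in> e'" using edges_meet[OF he z(1,3)] by blast
  obtain e'' where e'': "e'' \<in> P" "e'' \<noteq> e'" "w \<in> e''" by (rule sap_degree[OF P z(2) w(2)])
  have "f \<in> corners w" using e w by (simp add: face_borders_def)
  then have "e'' = e'"
    using f z(2) e'' w he sap_subset[OF P] by (intro non_bordering_edge_unique[of f w]) auto
  then show False using e'' by simp
qed

lemma face_borders_iff: "face_borders (a, b) e \<longleftrightarrow> e \<in>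
    {{(a, b, True), (a, b - 1, False)}, {(a, b - 1, True), (a, b - 1, False)},
     {(a, b - 1, True), (a - 1, b - 1, False)}, {(a - 1, b, True), (a - 1, b - 1, False)},
     {(a - 1, b, True), (a - 1, b, False)}, {(a, b, True), (a - 1, b, False)}}" (is "?L \<longleftrightarrow> ?R")
proof
  assume L: ?L
  then have "e \<in> hex_edges" by (simp add: face_borders_def)
  then show ?R
  proof (cases rule: hex_edges_cases)
    case (1 x y)
    show ?thesis using L unfolding 1 face_borders_simps by (elim disjE) simp_all
  next
    case (2 x y)
    show ?thesis using L unfolding 2 face_borders_simps by (elim disjE) simp_all
  next
    case (3 x y)
    show ?thesis using L unfolding 3 face_borders_simps by (elim disjE) simp_all
  qed
next
  assume ?R
  then show ?L
    using face_borders_simps(2)[of "(a, b)" a b] face_borders_simps(1)[of "(a, b)" a "b - 1"]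
      face_borders_simps(3)[of "(a, b)" a "b - 1"] face_borders_simps(2)[of "(a, b)" "a - 1" b]
      face_borders_simps(1)[of "(a, b)" "a - 1" b] face_borders_simps(3)[of "(a, b)" a b]
    by (elim insertE emptyE) simp_all
qed

text \<open>The border of such a face is connected and misses the polygon, so it lies in one
  component, and one of its edges is already in a bounded component.\<close>

lemma interior_face_edges:
  assumes P: "is_sap P" and f: "f \<in> dom_faces P - dom_inner_boundary P" and e: "face_borders f e"
  shows "e \<in> dom_edges P"
proof -
  let ?S = "- \<Union>(edge_pts ` P)"
  obtain a b where ab: "f = (a, b)" by fastforce
  have nP: "\<not> face_borders f e" if "e \<in> P" for e
    using f that by (auto simp: dom_inner_boundary_def)
  have sub: "edge_pts e \<subseteq> ?S" if "face_borders f e" for e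
    using face_border_avoids_sap[OF P nP that] by blast
  have seg: "connected_component ?S x y" if "face_borders f {u, v}" "x \<in> closed_segment (hpos u) (hpos v)"
    "y \<in> closed_segment (hpos u) (hpos v)" for u v x y
    unfolding connected_component_def
    using sub[OF that(1)] that(2,3) connected_segment(1)[of "hpos u" "hpos v"] unfolding edge_pts_pair by blast
  have step: "connected_component ?S (hpos u) (hpos v)" if "face_borders f {u, v}" for u v
    by (rule seg[OF that]) auto
  \<comment> \<open>The six corners in cyclic order. Edges are listed with the up-triangle first,
    hence the reversals in the chain below.\<close>
  let ?v0 = "(a, b, True)" and ?v1 = "(a, b - 1, False)" and ?v2 = "(a, b - 1, True)"
    and ?v3 = "(a - 1, b - 1, False)" and ?v4 = "(a - 1, b, True)" and ?v5 = "(a - 1, b, False)"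
  have 1: "connected_component ?S (hpos ?v0) (hpos ?v1)" by (rule step) (simp add: ab face_borders_iff)
  have 2: "connected_component ?S (hpos ?v0) (hpos ?v2)"
    by (rule connected_component_trans[OF 1 connected_component_sym[OF step]]) (simp add: ab face_borders_iff)
  have 3: "connected_component ?S (hpos ?v0) (hpos ?v3)"
    by (rule connected_component_trans[OF 2 step]) (simp add: ab face_borders_iff)
  have 4: "connected_component ?S (hpos ?v0) (hpos ?v4)"
    by (rule connected_component_trans[OF 3 connected_component_sym[OF step]]) (simp add: ab face_borders_iff)
  have 5: "connected_component ?S (hpos ?v0) (hpos ?v5)"
    by (rule connected_component_trans[OF 4 step]) (simp add: ab face_borders_iff)
  have all: "connected_component ?S (hpos ?v0) z" if e: "face_borders f e" and z: "z \<in> edge_pts e" for e z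
  proof -
    have "\<exists>u v. e = {u, v} \<and> connected_component ?S (hpos ?v0) (hpos u)"
      using e unfolding ab face_borders_iff using 1 2 3 4 5 connected_component_refl_eq
      by (metis connected_component_in insertE empty_iff)
    then obtain u v where uv: "e = {u, v}" "connected_component ?S (hpos ?v0) (hpos u)" by blast
    then show ?thesis
      using connected_component_trans[OF uv(2) seg[of u v "hpos u" z]] e z by (simp add: edge_pts_pair)
  qed
  have open_sub: "edge_open_pts e \<subseteq> edge_pts e" if "face_borders f e" for e
  proof -
    from that obtain u v where "e = {u, v}" unfolding ab face_borders_iff by blast
    then show ?thesis by (simp add: edge_open_pts_pair edge_pts_pair segment_open_subset_closed)
  qed
  from f obtain e0 where e0: "e0 \<in> dom_edges P" "face_borders f e0" by (auto simp: dom_faces_def)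
  then obtain C where C: "C \<in> components ?S" "bounded C" "edge_open_pts e0 \<subseteq> C" by (auto simp: dom_edges_def)
  \<comment> \<open>A point of the open edge is needed to identify \<open>C\<close> with the
    component containing the border of \<open>f\<close>.\<close>
  have "edge_open_pts e0 \<noteq> {}"
  proof -
    have "e0 \<in> hex_edges" using e0 by (simp add: face_borders_def)
    then obtain u v where uv: "e0 = {u, v}" "hpos u \<noteq> hpos v"
    proof (cases rule: hex_edges_cases)
      case (1 a b)
      then show thesis by (intro that[OF 1]) (simp add: hpos_eq lattice_pt_eq_iff)
    next
      case (2 a b)
      then show thesis by (intro that[OF 2]) (simp add: hpos_eq lattice_pt_eq_iff)
    next
      case (3 a b)
      then show thesis by (intro that[OF 3]) (simp add: hpos_eq lattice_pt_eq_iff)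
    qed
    then show ?thesis by (simp add: edge_open_pts_pair open_segment_eq_empty)
  qed
  then obtain z0 where z0: "z0 \<in> edge_open_pts e0" by blast
  then have "connected_component ?S (hpos ?v0) z0" using all[OF e0(2)] open_sub[OF e0(2)] by blast
  moreover have "C = connected_component_set ?S z0" using C z0 by (metis components_iff connected_component_eq subsetD)
  ultimately have Ceq: "C = connected_component_set ?S (hpos ?v0)" by (metis connected_component_eq_eq connected_component_in)
  have "edge_open_pts e \<subseteq> C" using all[OF e] open_sub[OF e] unfolding Ceq by blast
  moreover have "e \<in> hex_edges" using e by (simp add: face_borders_def)
  moreover have "e \<notin> P" using nP e by blast
  ultimately show ?thesis using C by (auto simp: dom_edges_def)
qed

text \<open>Bounded components of the complement lie in the \<open>inside\<close> of the compact
  polygon, which is bounded, and only finitely many edges have a point in a bounded region.\<close>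

lemma finite_dom_edges:
  assumes P: "is_sap P"
  shows "finite (dom_edges P)"
proof -
  let ?K = "\<Union>(edge_pts ` P)"
  have pair: "\<exists>u v. e = {u, v} \<and> hpos u \<noteq> hpos v" if "e \<in> hex_edges" for e
    using that by (cases rule: hex_edges_cases) (fastforce simp: hpos_eq lattice_pt_eq_iff)+
  have "bounded (edge_pts e)" if "e \<in> P" for e
  proof -
    from that obtain u v where "e = {u, v}" using pair[of e] sap_subset[OF P] by blast
    then show ?thesis by (simp add: edge_pts_pair bounded_closed_segment)
  qed
  then have "bounded ?K" using sap_finite[OF P] by (intro bounded_UN) auto
  then have "bounded (inside ?K)" by (intro bounded_inside) auto
  then obtain R where R: "\<And>z. z \<in> inside ?K \<Longrightarrow> norm z \<le> R" by (auto simp: bounded_iff)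
  \<comment> \<open>A norm bound \<open>R\<close> bounds both skew coordinates by
    \<open>2 * R\<close>, and the integer labels of the edge differ from them by at most 1.\<close>
  obtain N :: nat where N: "2 * R + 2 \<le> real N" using real_arch_simple by blast
  have "e \<in> (\<Union>a\<in>{- int N..int N}. \<Union>b\<in>{- int N..int N}.
      {{(a, b, True), (a, b, False)}, {(a, b, True), (a, b - 1, False)}, {(a, b, True), (a - 1, b, False)}})"
    (is "e \<in> ?X") if e: "e \<in> dom_edges P" for e
  proof -
    have he: "e \<in> hex_edges" using e by (simp add: dom_edges_def)
    obtain C where C: "C \<in> components (- ?K)" "bounded C" "edge_open_pts e \<subseteq> C" using e by (auto simp: dom_edges_def)
    obtain u v where uv: "e = {u, v}" "hpos u \<noteq> hpos v" using pair[OF he] by blast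
    then obtain z where z: "z \<in> edge_open_pts e" by (metis edge_open_pts_pair open_segment_eq_empty ex_in_conv)
    then have "C = connected_component_set (- ?K) z" "z \<notin> ?K"
      using C by (metis components_iff connected_component_eq subsetD, metis components_iff C(1,3) in_components_subset subsetD ComplD z)
    then have "z \<in> inside ?K" using C(2) by (simp add: inside_def)
    then have nz: "norm z \<le> R" by (rule R)
    have ze: "z \<in> edge_pts e" using z uv by (simp add: edge_open_pts_pair edge_pts_pair segment_open_subset_closed[THEN subsetD])
    have bnd: "a \<in> {- int N..int N}" "b \<in> {- int N..int N}"
      if st: "z = lattice_pt s t" "\<bar>s - of_int a\<bar> \<le> 1" "\<bar>t - of_int b\<bar> \<le> 1" for a b :: int and s t :: real
    proof -
      have "\<bar>t * (sqrt 3 / 2)\<bar> \<le> R" using abs_Im_le_cmod[of z] nz st by (simp add: Im_lattice_pt)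
      moreover have "\<bar>t\<bar> * (1 / 2) \<le> \<bar>t\<bar> * (sqrt 3 / 2)" by (intro mult_left_mono) auto
      then have "\<bar>t\<bar> * (1 / 2) \<le> \<bar>t * (sqrt 3 / 2)\<bar>" by (simp add: abs_mult)
      ultimately have t: "\<bar>t\<bar> \<le> 2 * R" by linarith
      have "\<bar>s + t / 2\<bar> \<le> R" using abs_Re_le_cmod[of z] nz st by (simp add: Re_lattice_pt)
      then have s: "\<bar>s\<bar> \<le> 2 * R" using t by linarith
      have "\<bar>real_of_int a\<bar> \<le> real N" "\<bar>real_of_int b\<bar> \<le> real N" using s t st N by linarith+
      then show "a \<in> {- int N..int N}" "b \<in> {- int N..int N}" by (auto simp: abs_le_iff)
    qed
    from he ze show ?thesis
    proof (cases rule: edge_pts_cases)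
      case (diag a b l)
      then have "a \<in> {- int N..int N}" "b \<in> {- int N..int N}" by (intro bnd[OF diag(4), of a b]; simp)+
      then show ?thesis using diag(3) by blast
    next
      case (down a b l)
      then have "a \<in> {- int N..int N}" "b \<in> {- int N..int N}" by (intro bnd[OF down(4), of a b]; simp)+
      then show ?thesis using down(3) by blast
    next
      case (left a b l)
      then have "a \<in> {- int N..int N}" "b \<in> {- int N..int N}" by (intro bnd[OF left(4), of a b]; simp)+
      then show ?thesis using left(3) by blast
    qed
  qed
  then have "dom_edges P \<subseteq> ?X" by blast
  then show ?thesis by (rule finite_subset) auto
qed

lemma finite_dom_faces:
  assumes "is_sap P"
  shows "finite (dom_faces P)"
proof -
  have "dom_faces P \<subseteq> (\<Union>e\<in>dom_edges P. \<Union>v\<in>e. corners v)"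
  proof
    fix f assume "f \<in> dom_faces P"
    then obtain e where e: "e \<in> dom_edges P" "face_borders f e" by (auto simp: dom_faces_def)
    then have "e \<in> hex_edges" by (simp add: dom_edges_def)
    then have "e \<noteq> {}" by (cases rule: hex_edges_cases) auto
    then show "f \<in> (\<Union>e\<in>dom_edges P. \<Union>v\<in>e. corners v)" using e by (auto simp: face_borders_def)
  qed
  moreover have "finite e" if "e \<in> dom_edges P" for e
  proof -
    have "e \<in> hex_edges" using that by (simp add: dom_edges_def)
    then show ?thesis by (cases rule: hex_edges_cases) auto
  qed
  moreover have "finite (corners v)" for v by (cases v) (auto simp: corners_def)
  ultimately show ?thesis using finite_dom_edges[OF assms] by (meson finite_UN_I finite_subset)
qed

section \<open>Interior faces and the finite-volume law of a domain\<close>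

definition interior_faces :: "hedge set \<Rightarrow> face set" where
  "interior_faces P = dom_faces P - dom_inner_boundary P"

text \<open>Makes \<open>card_compat\<close> applicable with the domain as ambient region: no
  constraint of an admissible minus set leaves it.\<close>

lemma nbh_interior_faces: "is_sap P \<Longrightarrow> nbh (interior_faces P) \<subseteq> dom_faces P"
proof
  fix g assume P: "is_sap P" and "g \<in> nbh (interior_faces P)"
  then consider "g \<in> interior_faces P" | f where "f \<in> interior_faces P" "face_adj f g" by (auto simp: nbh_def)
  then show "g \<in> dom_faces P"
  proof cases
    case 1
    then show ?thesis by (simp add: interior_faces_def)
  next
    case 2
    then obtain e where e: "face_borders f e" "face_borders g e" by (auto simp: face_adj_def)
    then have "e \<in> dom_edges P" using interior_face_edges[OF P] 2 by (simp add: interior_faces_def)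
    then show ?thesis using e by (auto simp: dom_faces_def)
  qed
qed

lemma interior_facesI:
  assumes "\<And>e. face_borders f e \<Longrightarrow> e \<in> dom_edges P"
  shows "f \<in> interior_faces P"
proof -
  obtain a b where "f = (a, b)" by fastforce
  then have "\<exists>e. face_borders f e" by (auto simp: face_borders_iff)
  then have "f \<in> dom_faces P" using assms by (auto simp: dom_faces_def)
  moreover have "f \<notin> dom_inner_boundary P" using assms by (auto simp: dom_inner_boundary_def dom_edges_def)
  ultimately show ?thesis by (simp add: interior_faces_def)
qed

text \<open>Plus on the inner boundary puts the minus set into the interior, and each such set has
  \<open>wt M\<close> times a power of two coherent blue partners. That power is the same for all
  \<open>M\<close> and cancels in \<open>nu_plus_free\<close>.\<close>

lemma card_plus_free_pairs:
  assumes P: "is_sap P"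
  shows "real (card {p \<in> plus_free_pairs P. fst p \<in> A})
    = sum wt (Pow (interior_faces P) \<inter> {M. cfg_of M \<in> A}) * 2 ^ card (dom_faces P)"
proof -
  let ?F = "dom_faces P" and ?I = "interior_faces P"
  let ?X = "Pow ?I \<inter> {M. cfg_of M \<in> A}"
  have fin: "finite ?F" "finite ?I" using finite_dom_faces[OF P] by (auto simp: interior_faces_def)
  have IF: "?I \<subseteq> ?F" by (auto simp: interior_faces_def)
  have nbh: "nbh M \<subseteq> ?F" if "M \<subseteq> ?I" for M using nbh_mono[OF that] nbh_interior_faces[OF P] by blast
  have eq1: "(b = 0 \<longleftrightarrow> c = 0) \<longleftrightarrow> b = c" for b c :: bit by (cases b; cases c) auto
  \<comment> \<open>\<open>coherent\<close> only looks at edges inside the domain, the right side at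
    all edges; they agree because the neighbours of \<open>M\<close> belong to the domain.\<close>
  have coh: "coherent ?F (cfg_of M) (\<lambda>f. b f = 0) \<longleftrightarrow> (\<forall>u v. face_adj u v \<longrightarrow> u \<in> M \<longrightarrow> v \<notin> M \<longrightarrow> b u = b v)"
    if M: "M \<subseteq> ?I" for M and b :: "face \<Rightarrow> bit"
  proof
    assume L: "coherent ?F (cfg_of M) (\<lambda>f. b f = 0)"
    show "\<forall>u v. face_adj u v \<longrightarrow> u \<in> M \<longrightarrow> v \<notin> M \<longrightarrow> b u = b v"
    proof (intro allI impI)
      fix u v assume uv: "face_adj u v" "u \<in> M" "v \<notin> M"
      then have "u \<in> ?F" "v \<in> ?F" using nbh[OF M] by (auto simp: nbh_def)
      then have "cfg_of M u = cfg_of M v \<or> (b u = 0) = (b v = 0)" using L uv(1) by (simp add: coherent_def)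
      then have "(b u = 0) = (b v = 0)" using uv by (simp add: cfg_of_def)
      then show "b u = b v" by (rule eq1[THEN iffD1])
    qed
  next
    assume R: "\<forall>u v. face_adj u v \<longrightarrow> u \<in> M \<longrightarrow> v \<notin> M \<longrightarrow> b u = b v"
    show "coherent ?F (cfg_of M) (\<lambda>f. b f = 0)"
      unfolding coherent_def
    proof (intro ballI impI)
      fix u v assume uv: "u \<in> ?F" "v \<in> ?F" "face_adj u v"
      show "cfg_of M u = cfg_of M v \<or> (b u = 0) = (b v = 0)"
      proof (cases "u \<in> M \<longleftrightarrow> v \<in> M")
        case True
        then show ?thesis by (simp add: cfg_of_def)
      next
        case False
        then have "b u = b v" using R uv(3) face_adj_sym[OF uv(3)] by metis
        then show ?thesis by simp
      qed
    qed
  qed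
  \<comment> \<open>Blue plus is sent to 0, so that the convention of pluses outside the domain
    becomes \<open>supported\<close>.\<close>
  let ?h = "\<lambda>(M, b::face \<Rightarrow> bit). (cfg_of M, \<lambda>f. b f = 0)"
  let ?g = "\<lambda>p. ({f. \<not> fst p f}, \<lambda>f. if snd p f then 0 else 1 :: bit)"
  have "bij_betw ?h (Sigma ?X (compat ?F)) {p \<in> plus_free_pairs P. fst p \<in> A}"
  proof (rule bij_betwI[where g = ?g])
    show "?h \<in> Sigma ?X (compat ?F) \<rightarrow> {p \<in> plus_free_pairs P. fst p \<in> A}"
    proof (rule funcsetI, clarify)
      fix M b assume M: "M \<subseteq> ?I" "cfg_of M \<in> A" and b: "b \<in> compat ?F M"
      have "coherent ?F (cfg_of M) (\<lambda>f. b f = 0)" using b coh[OF M(1)] by (simp add: compat_def)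
      moreover have "cfg_of M \<in> cfgs ?F" using M IF by (auto simp: cfgs_def cfg_of_def)
      moreover have "(\<lambda>f. b f = 0) \<in> cfgs ?F" using b by (auto simp: cfgs_def compat_def supported_def)
      moreover have "cfg_of M f" if "f \<in> dom_inner_boundary P" for f
        using that M by (auto simp: cfg_of_def interior_faces_def)
      ultimately show "(cfg_of M, \<lambda>f. b f = 0) \<in> plus_free_pairs P \<and> fst (cfg_of M, \<lambda>f. b f = 0) \<in> A"
        using M by (simp add: plus_free_pairs_def)
    qed
    show "?g \<in> {p \<in> plus_free_pairs P. fst p \<in> A} \<rightarrow> Sigma ?X (compat ?F)"
    proof (rule funcsetI)
      fix p assume p: "p \<in> {p \<in> plus_free_pairs P. fst p \<in> A}"
      let ?M = "{f. \<not> fst p f}" and ?b = "\<lambda>f. if snd p f then 0 else 1 :: bit"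
      have c: "cfg_of ?M = fst p" "(\<lambda>f. ?b f = 0) = snd p" by (auto simp: cfg_of_def)
      have p': "fst p \<in> cfgs ?F" "snd p \<in> cfgs ?F" "coherent ?F (fst p) (snd p)" "\<forall>f\<in>dom_inner_boundary P. fst p f"
        using p by (auto simp: plus_free_pairs_def case_prod_unfold)
      have M: "?M \<subseteq> ?I" using p'(1,4) by (auto simp: cfgs_def interior_faces_def)
      have "?b \<in> compat ?F ?M"
        using coh[OF M, of ?b] p'(2,3) unfolding c by (auto simp: compat_def supported_def cfgs_def)
      then show "?g p \<in> Sigma ?X (compat ?F)" using M p c by simp
    qed
    show "?g (?h p) = p" for p
      by (auto simp: case_prod_unfold cfg_of_def fun_eq_iff prod_eq_iff)
    show "?h (?g p) = p" for p
      by (auto simp: case_prod_unfold cfg_of_def fun_eq_iff prod_eq_iff)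
  qed
  then have "card {p \<in> plus_free_pairs P. fst p \<in> A} = card (Sigma ?X (compat ?F))"
    by (simp add: bij_betw_same_card)
  also have "\<dots> = (\<Sum>M\<in>?X. card (compat ?F M))"
    using fin by (intro card_SigmaI) auto
  finally have "real (card {p \<in> plus_free_pairs P. fst p \<in> A}) = (\<Sum>M\<in>?X. real (card (compat ?F M)))" by simp
  also have "\<dots> = (\<Sum>M\<in>?X. wt M * 2 ^ card ?F)"
    using fin nbh by (intro sum.cong refl card_compat) auto
  finally show ?thesis by (simp add: sum_distrib_right)
qed

theorem nu_plus_free_eq_fv:
  assumes "is_sap P"
  shows "nu_plus_free P A = fv (interior_faces P) A"
  using card_plus_free_pairs[OF assms, of A] card_plus_free_pairs[OF assms, of UNIV]
  by (simp add: nu_plus_free_def fv_def Zsum_def)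

text \<open>The exhaustion is by edges, the limit by faces: a face is interior as soon as its six
  edges belong to the domain, which then persists by monotonicity.\<close>

lemma filterlim_interior_faces:
  assumes P: "\<And>n. is_sap (P n)" and mono: "\<And>n. dom_edges (P n) \<subseteq> dom_edges (P (Suc n))"
    and exh: "(\<Union>n. dom_edges (P n)) = hex_edges"
  shows "filterlim (\<lambda>n. interior_faces (P n)) fin_sets sequentially"
proof -
  have mono': "dom_edges (P m) \<subseteq> dom_edges (P n)" if "m \<le> n" for m n
    using mono that by (rule lift_Suc_mono_le)
  have edge: "\<forall>\<^sub>F n in sequentially. e \<in> dom_edges (P n)" if "e \<in> hex_edges" for e
  proof -
    from that obtain m where m: "e \<in> dom_edges (P m)" unfolding exh[symmetric] by blast
    show ?thesis
      using eventually_ge_at_top[of m]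
    proof eventually_elim
      case (elim n)
      show ?case using mono'[OF elim] m by blast
    qed
  qed
  have face: "\<forall>\<^sub>F n in sequentially. f \<in> interior_faces (P n)" for f
  proof -
    have "finite {e. face_borders f e}" by (cases f) (simp add: face_borders_iff)
    then have "\<forall>\<^sub>F n in sequentially. \<forall>e\<in>{e. face_borders f e}. e \<in> dom_edges (P n)"
      by (rule eventually_ball_finite) (auto intro: edge simp: face_borders_def)
    then show ?thesis by eventually_elim (auto intro: interior_facesI)
  qed
  show ?thesis
    unfolding filterlim_def le_filter_def eventually_filtermap
  proof (intro allI impI)
    fix Q assume "eventually Q fin_sets"
    then obtain X where X: "finite X" "\<And>Y. finite Y \<Longrightarrow> X \<subseteq> Y \<Longrightarrow> Q Y"
      by (auto simp: eventually_finite_subsets_at_top)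
    have "\<forall>\<^sub>F n in sequentially. \<forall>f\<in>X. f \<in> interior_faces (P n)"
      using X(1) face by (intro eventually_ball_finite) auto
    then show "\<forall>\<^sub>F n in sequentially. Q (interior_faces (P n))"
    proof eventually_elim
      case (elim n)
      have "finite (interior_faces (P n))" using finite_dom_faces[OF P] by (simp add: interior_faces_def)
      then show ?case using elim by (intro X(2)) auto
    qed
  qed
qed

section \<open>The infinite-volume measure\<close>

lemma sets_cfg_space_coord: "{\<omega>. \<omega> f} \<in> sets cfg_space"
proof -
  have "(\<lambda>\<omega>. \<omega> f) \<in> measurable cfg_space (count_space UNIV)"
    unfolding cfg_space_def by (rule measurable_component_singleton) simp
  from measurable_sets[OF this, of "{True}"] show ?thesis
    by (simp add: cfg_space_def space_PiM vimage_def)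
qed

lemma space_cfg_space [simp]: "space cfg_space = UNIV"
  by (simp add: cfg_space_def space_PiM)

lemma all_plus_measurable: "finite U \<Longrightarrow> all_plus U \<in> sets cfg_space"
proof (induction U rule: finite_induct)
  case empty
  then show ?case using sets.top[of cfg_space] by (simp add: all_plus_def)
next
  case (insert f U)
  have "all_plus (insert f U) = {\<omega>. \<omega> f} \<inter> all_plus U" by (auto simp: all_plus_def)
  then show ?case using insert sets_cfg_space_coord by auto
qed

lemma cylinder_measurable:
  assumes "cylinder_event A"
  shows "A \<in> sets cfg_space"
proof -
  obtain S c where S: "finite S" and c: "\<And>\<omega>. indicat_real A \<omega> = (\<Sum>U\<in>Pow S. c U * indicat_real (all_plus U) \<omega>)"
    using cylinder_expansion[OF assms] by blast
  have "indicat_real (all_plus U) \<in> borel_measurable cfg_space" if "U \<in> Pow S" for U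
    using that finite_subset[OF _ S] by (intro borel_measurable_indicator all_plus_measurable) auto
  then have "(\<lambda>\<omega>. \<Sum>U\<in>Pow S. c U * indicat_real (all_plus U) \<omega>) \<in> borel_measurable cfg_space"
    by (intro borel_measurable_sum borel_measurable_times borel_measurable_const) auto
  then have "indicat_real A \<in> borel_measurable cfg_space" by (simp add: c[symmetric])
  then show ?thesis by (simp add: borel_measurable_indicator_iff)
qed

text \<open>The index set is arbitrary, because \<open>cylinder_mixing\<close> expands over pairs of
  subsets.\<close>

lemma measure_expansion:
  assumes "prob_space \<nu>" "sets \<nu> = sets cfg_space" "finite K"
    and U: "\<And>k. k \<in> K \<Longrightarrow> finite (U k)"
    and A: "A \<in> sets cfg_space"
    and c: "\<And>\<omega>. indicat_real A \<omega> = (\<Sum>k\<in>K. c k * indicat_real (all_plus (U k)) \<omega>)"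
  shows "measure \<nu> A = (\<Sum>k\<in>K. c k * measure \<nu> (all_plus (U k)))"
proof -
  interpret prob_space \<nu> by fact
  have sp: "space \<nu> = UNIV" using sets_eq_imp_space_eq[OF assms(2)] by simp
  have m: "all_plus (U k) \<in> sets \<nu>" if "k \<in> K" for k using all_plus_measurable[OF U[OF that]] assms by simp
  have "measure \<nu> A = (\<integral>\<omega>. indicat_real A \<omega> \<partial>\<nu>)" using A assms(2) by (simp add: sp)
  also have "\<dots> = (\<integral>\<omega>. (\<Sum>k\<in>K. c k * indicat_real (all_plus (U k)) \<omega>) \<partial>\<nu>)" by (simp only: c)
  also have "\<dots> = (\<Sum>k\<in>K. c k * (\<integral>\<omega>. indicat_real (all_plus (U k)) \<omega> \<partial>\<nu>))"
    using m by (subst Bochner_Integration.integral_sum) (auto intro!: integrable_mult_right integrable_real_indicator simp: less_top[symmetric])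
  also have "\<dots> = (\<Sum>k\<in>K. c k * measure \<nu> (all_plus (U k)))"
    using m by (intro sum.cong) (auto simp: sp)
  finally show ?thesis .
qed

text \<open>The marginal on \<open>J\<close>, with spins written as the reals 0 and 1, so that the
  projective limit theorem for Polish spaces applies.\<close>

definition proj_law :: "face set \<Rightarrow> (face \<Rightarrow> real) measure" where
  "proj_law J = distr (point_measure (Pow J) (\<lambda>M. ennreal (lv {\<omega>. \<forall>f\<in>J. \<omega> f \<longleftrightarrow> f \<notin> M})))
    (PiM J (\<lambda>_. borel)) (\<lambda>M. \<lambda>f\<in>J. of_bool (f \<notin> M))"

lemma emeasure_proj_law:
  assumes J: "finite J" and X: "X \<in> sets (PiM J (\<lambda>_. borel))"
  shows "emeasure (proj_law J) X = ennreal (lv {\<omega>. (\<lambda>f\<in>J. of_bool (\<omega> f)) \<in> X})"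
proof -
  let ?h = "\<lambda>M. \<lambda>f\<in>J. of_bool (f \<notin> M) :: real" and ?C = "\<lambda>M. {\<omega>::face \<Rightarrow> bool. \<forall>f\<in>J. \<omega> f \<longleftrightarrow> f \<notin> M}"
  let ?K = "Pow J \<inter> ?h -` X"
  have cyl: "cylinder_event (?C M)" for M using J by (auto simp: cylinder_event_def)
  have h: "?h \<in> measurable (point_measure (Pow J) (\<lambda>M. ennreal (lv (?C M)))) (PiM J (\<lambda>_. borel))"
    by (auto simp: measurable_point_measure_eq1 space_PiM)
  have h': "(\<lambda>f\<in>J. of_bool (\<omega> f)) = ?h M" if "\<omega> \<in> ?C M" for \<omega> M using that by (auto simp: fun_eq_iff)
  have mem: "\<omega> \<in> ?C {f\<in>J. \<not> \<omega> f}" for \<omega> by auto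
  have UN: "(\<Union>M\<in>?K. ?C M) = {\<omega>. (\<lambda>f\<in>J. of_bool (\<omega> f)) \<in> X}"
  proof (intro equalityI subsetI)
    fix \<omega> assume "\<omega> \<in> (\<Union>M\<in>?K. ?C M)"
    then obtain M where "M \<in> ?K" "\<omega> \<in> ?C M" by blast
    then show "\<omega> \<in> {\<omega>. (\<lambda>f\<in>J. of_bool (\<omega> f)) \<in> X}" using h'[of \<omega> M] by simp
  next
    fix \<omega> assume "\<omega> \<in> {\<omega>. (\<lambda>f\<in>J. of_bool (\<omega> f) :: real) \<in> X}"
    then have "{f\<in>J. \<not> \<omega> f} \<in> ?K" using h'[OF mem[of \<omega>]] by auto
    then show "\<omega> \<in> (\<Union>M\<in>?K. ?C M)" using mem by blast
  qed
  have "emeasure (proj_law J) X = emeasure (point_measure (Pow J) (\<lambda>M. ennreal (lv (?C M)))) (?h -` X \<inter> Pow J)"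
    unfolding proj_law_def using emeasure_distr[OF h X] by (simp add: space_point_measure)
  also have "\<dots> = (\<Sum>M\<in>?K. ennreal (lv (?C M)))"
    using J by (subst emeasure_point_measure_finite) (auto simp: Int_commute)
  also have "\<dots> = ennreal (\<Sum>M\<in>?K. lv (?C M))" by (intro sum_ennreal lv_nonneg cyl)
  also have "(\<Sum>M\<in>?K. lv (?C M)) = lv (\<Union>M\<in>?K. ?C M)"
  proof (rule lv_sum_disjoint[symmetric])
    show "disjoint_family_on ?C ?K" by (fastforce simp: disjoint_family_on_def)
    show "cylinder_event (\<Union>M\<in>?K. ?C M)"
      unfolding cylinder_event_def using J by (intro exI[of _ J]) auto
  qed (use J cyl in auto)
  finally show ?thesis by (simp only: UN)
qed

lemma sets_proj_law [simp]: "sets (proj_law J) = sets (PiM J (\<lambda>_. borel))"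
  by (simp add: proj_law_def)

lemma space_proj_law [simp]: "space (proj_law J) = space (PiM J (\<lambda>_. borel))"
  by (simp add: proj_law_def)

text \<open>Consistency is automatic: by \<open>emeasure_proj_law\<close> both marginals are
  \<open>lv\<close> of the same event of spin configurations.\<close>

lemma polish_projective_proj_law: "polish_projective UNIV proj_law"
proof (intro polish_projective.intro projective_family.intro)
  fix J H :: "face set" assume JH: "J \<subseteq> H" "finite H"
  have J: "finite J" using JH finite_subset by blast
  show "proj_law J = distr (proj_law H) (PiM J (\<lambda>_. borel)) (\<lambda>f. restrict f J)"
  proof (rule measure_eqI)
    fix X assume "X \<in> sets (proj_law J)"
    then have X: "X \<in> sets (PiM J (\<lambda>_. borel))" by simp
    have r: "(\<lambda>f. restrict f J) \<in> measurable (proj_law H) (PiM J (\<lambda>_. borel :: real measure))"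
      using measurable_restrict_subset[OF JH(1), of "\<lambda>_. borel"] by (simp add: measurable_def)
    let ?Y = "(\<lambda>f. restrict f J) -` X \<inter> space (PiM H (\<lambda>_. borel))"
    have Y: "?Y \<in> sets (PiM H (\<lambda>_. borel))" using measurable_sets[OF r X] by simp
    have "emeasure (distr (proj_law H) (PiM J (\<lambda>_. borel)) (\<lambda>f. restrict f J)) X = emeasure (proj_law H) ?Y"
      using emeasure_distr[OF r X] by simp
    also have "\<dots> = ennreal (lv {\<omega>. (\<lambda>f\<in>H. of_bool (\<omega> f)) \<in> ?Y})" by (rule emeasure_proj_law[OF JH(2) Y])
    also have "{\<omega>. (\<lambda>f\<in>H. of_bool (\<omega> f)) \<in> ?Y} = {\<omega>. (\<lambda>f\<in>J. of_bool (\<omega> f)) \<in> X}"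
    proof -
      have "restrict (\<lambda>f\<in>H. of_bool (\<omega> f) :: real) J = (\<lambda>f\<in>J. of_bool (\<omega> f))" for \<omega>
        using JH(1) by (auto simp: fun_eq_iff)
      then show ?thesis by (auto simp: space_PiM)
    qed
    finally show "emeasure (proj_law J) X = emeasure (distr (proj_law H) (PiM J (\<lambda>_. borel)) (\<lambda>f. restrict f J)) X"
      by (simp only: emeasure_proj_law[OF J X])
  qed simp
next
  fix J :: "face set" assume J: "finite J"
  show "prob_space (proj_law J)"
  proof (rule prob_spaceI)
    have "emeasure (proj_law J) (space (PiM J (\<lambda>_. borel))) = ennreal (lv {\<omega>. (\<lambda>f\<in>J. of_bool (\<omega> f)) \<in> space (PiM J (\<lambda>_. borel :: real measure))})"
      by (rule emeasure_proj_law[OF J]) (rule sets.top)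
    also have "{\<omega>. (\<lambda>f\<in>J. of_bool (\<omega> f)) \<in> space (PiM J (\<lambda>_. borel :: real measure))} = UNIV" by (auto simp: space_PiM)
    finally show "emeasure (proj_law J) (space (proj_law J)) = 1" by (simp add: lv_UNIV)
  qed
qed

lemma infinite_volume_measure_exists:
  obtains \<nu> where "prob_space \<nu>" "sets \<nu> = sets cfg_space" "\<And>A. cylinder_event A \<Longrightarrow> measure \<nu> A = lv A"
proof -
  interpret polish_projective UNIV proj_law by (rule polish_projective_proj_law)
  \<comment> \<open>Reads spins off a real configuration; 1/2 separates the values 0 and 1.\<close>
  let ?dec = "\<lambda>(x::face \<Rightarrow> real) f. x f > 1 / 2"
  have dec: "?dec \<in> measurable lim cfg_space"
    unfolding cfg_space_def
  proof (rule measurable_PiM_single')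
    fix f :: face
    have "(\<lambda>x. x f) \<in> measurable (PiM UNIV (\<lambda>_. borel :: real measure)) borel"
      by (rule measurable_component_singleton) simp
    then have "(\<lambda>x. x f) \<in> borel_measurable lim" by (simp add: measurable_def)
    then show "(\<lambda>x. 1 / 2 < x f) \<in> measurable lim (count_space UNIV)" by measurable
  qed (auto simp: space_PiM)
  define \<nu> where "\<nu> = distr lim cfg_space ?dec"
  have prob: "prob_space \<nu>" unfolding \<nu>_def by (rule P.prob_space_distr[OF dec])
  have sets: "sets \<nu> = sets cfg_space" by (simp add: \<nu>_def)
  \<comment> \<open>All-plus events are rectangles for the projective limit; the other cylinder
    events follow by linearity.\<close>
  have plus: "measure \<nu> (all_plus U) = lv (all_plus U)" if U: "finite U" for U
  proof -
    let ?X = "PiE U (\<lambda>_. {1 / 2 <..} :: real set)"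
    have X: "?X \<in> sets (PiM U (\<lambda>_. borel))" by (rule sets_PiM_I_finite[OF U]) simp
    have "?dec -` all_plus U \<inter> space lim = prod_emb UNIV (\<lambda>_. borel) U ?X"
      by (auto simp: all_plus_def prod_emb_def space_PiM PiE_iff)
    then have "measure \<nu> (all_plus U) = measure lim (prod_emb UNIV (\<lambda>_. borel) U ?X)"
      unfolding \<nu>_def by (simp only: measure_distr[OF dec all_plus_measurable[OF U]])
    also have "\<dots> = measure (proj_law U) ?X" by (rule measure_lim_emb[OF _ U X]) simp
    also have "\<dots> = lv {\<omega>. (\<lambda>f\<in>U. of_bool (\<omega> f)) \<in> ?X}"
    proof -
      have "cylinder_event {\<omega>. (\<lambda>f\<in>U. of_bool (\<omega> f)) \<in> ?X}"
        unfolding cylinder_event_def using U by (intro exI[of _ U]) (auto simp: PiE_iff)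
      then show ?thesis by (simp add: measure_def emeasure_proj_law[OF U X] lv_nonneg)
    qed
    also have "{\<omega>. (\<lambda>f\<in>U. of_bool (\<omega> f)) \<in> ?X} = all_plus U"
      by (auto simp: all_plus_def PiE_iff of_bool_def split: if_splits)
    finally show ?thesis .
  qed
  have "measure \<nu> A = lv A" if A: "cylinder_event A" for A
  proof -
    obtain S c where S: "finite S" and c: "\<And>\<omega>. indicat_real A \<omega> = (\<Sum>U\<in>Pow S. c U * indicat_real (all_plus U) \<omega>)"
      using cylinder_expansion[OF A] by blast
    have fin: "finite U" if "U \<in> Pow S" for U using that S finite_subset by blast
    have "measure \<nu> A = (\<Sum>U\<in>Pow S. c U * measure \<nu> (all_plus U))"
      using S fin by (intro measure_expansion[OF prob sets _ _ cylinder_measurable[OF A] c]) auto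
    also have "\<dots> = (\<Sum>U\<in>Pow S. c U * lv (all_plus U))"
      using fin plus by (intro sum.cong) auto
    also have "\<dots> = lv A"
    proof (rule lv_unique[OF A, symmetric])
      have "((\<lambda>I. \<Sum>U\<in>Pow S. c U * fv I (all_plus U)) \<longlongrightarrow> (\<Sum>U\<in>Pow S. c U * lv (all_plus U))) fin_sets"
        using fin by (intro tendsto_sum tendsto_mult_left fv_tendsto cylinder_all_plus)
      moreover have "\<forall>\<^sub>F I in fin_sets. (\<Sum>U\<in>Pow S. c U * fv I (all_plus U)) = fv I A"
        using eventually_finite_fin_sets by eventually_elim (simp add: fv_expansion[OF _ c])
      ultimately show "((\<lambda>I. fv I A) \<longlongrightarrow> (\<Sum>U\<in>Pow S. c U * lv (all_plus U))) fin_sets"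
        by (rule Lim_transform_eventually)
    qed
    finally show ?thesis .
  qed
  with prob sets show thesis by (rule that)
qed

section \<open>Approximation by cylinder events\<close>

text \<open>Sequential compactness for the product topology: spins being discrete, convergence at a
  face means being eventually equal there.\<close>

definition seq_compact_cfgs :: "(face \<Rightarrow> bool) set \<Rightarrow> bool" where
  "seq_compact_cfgs K \<longleftrightarrow> (\<forall>k. (\<forall>n::nat. k n \<in> K) \<longrightarrow>
    (\<exists>l\<in>K. \<exists>r. strict_mono r \<and> (\<forall>f. \<forall>\<^sub>F n in sequentially. k (r n) f = l f)))"

text \<open>Inner regularity holds for the image measure on the Polish space of real configurations;
  a compact set found there is pulled back to spins.\<close>

lemma inner_seq_compact:
  assumes "prob_space \<nu>" and sets: "sets \<nu> = sets cfg_space" and A: "A \<in> sets \<nu>" and \<epsilon>: "\<epsilon> > 0"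
  obtains K where "K \<subseteq> A" "K \<in> sets \<nu>" "seq_compact_cfgs K" "measure \<nu> A < measure \<nu> K + \<epsilon>"
\<comment> \<open>In the remaining case \<open>measure \<nu> A - \<epsilon>\<close> is nonnegative,
  so it survives the passage to extended nonnegative reals.\<close>
proof (cases "measure \<nu> A < \<epsilon>")
  case True
  show thesis by (rule that[of "{}"]) (use True in \<open>auto simp: seq_compact_cfgs_def\<close>)
next
  case False
  interpret prob_space \<nu> by fact
  let ?emb = "\<lambda>(\<omega>::face \<Rightarrow> bool) f. of_bool (\<omega> f) :: real" and ?dec = "\<lambda>(x::face \<Rightarrow> real) f. x f > 1 / 2"
  have sp: "space \<nu> = UNIV" using sets_eq_imp_space_eq[OF sets] by simp
  have de: "?dec (?emb \<omega>) = \<omega>" for \<omega> by (auto simp: fun_eq_iff)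
  have coord: "(\<lambda>\<omega>. \<omega> f) \<in> measurable \<nu> (count_space UNIV)" for f
    using measurable_component_singleton[of f UNIV "\<lambda>_. count_space (UNIV :: bool set)"]
    unfolding cfg_space_def[symmetric] by (simp add: measurable_cong_sets[OF sets refl])
  have emb: "?emb \<in> measurable \<nu> borel"
  proof (rule measurable_coordinatewise_then_product)
    fix f :: face
    show "(\<lambda>\<omega>. of_bool (\<omega> f) :: real) \<in> borel_measurable \<nu>"
      using measurable_comp[OF coord[of f], of of_bool borel] by (simp add: o_def)
  qed
  have dec: "?dec \<in> measurable borel cfg_space"
    unfolding cfg_space_def
  proof (rule measurable_PiM_single')
    fix f :: face
    have "(\<lambda>x. x f) \<in> borel_measurable (borel :: (face \<Rightarrow> real) measure)"
      by (rule borel_measurable_continuous_onI) (rule continuous_on_product_coordinates)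
    then show "(\<lambda>x. 1 / 2 < x f) \<in> measurable (borel :: (face \<Rightarrow> real) measure) (count_space UNIV)" by measurable
  qed (auto simp: space_PiM)
  let ?\<mu> = "distr \<nu> borel ?emb" and ?B = "?dec -` A"
  interpret \<mu>: prob_space ?\<mu> by (rule prob_space_distr[OF emb])
  have B: "?B \<in> sets borel" using measurable_sets[OF dec, of A] A sets by simp
  have "emeasure ?\<mu> ?B = emeasure \<nu> A"
    using emeasure_distr[OF emb B] by (simp add: vimage_def de sp)
  then have "(SUP K \<in> {K. K \<subseteq> ?B \<and> compact K}. emeasure ?\<mu> K) = ennreal (measure \<nu> A)"
    using inner_regular[of ?\<mu> ?B] B by (simp add: emeasure_eq_measure)
  moreover have "ennreal (measure \<nu> A - \<epsilon>) < ennreal (measure \<nu> A)"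
    using False \<epsilon> by (simp add: ennreal_less_iff)
  ultimately have "ennreal (measure \<nu> A - \<epsilon>) < (SUP K \<in> {K. K \<subseteq> ?B \<and> compact K}. emeasure ?\<mu> K)"
    by simp
  then obtain K' where K': "K' \<subseteq> ?B" "compact K'" "ennreal (measure \<nu> A - \<epsilon>) < emeasure ?\<mu> K'"
    by (auto simp: less_SUP_iff)
  define K where "K = ?emb -` K'"
  have K'b: "K' \<in> sets borel" using K'(2) by (simp add: borel_closed compact_imp_closed)
  have Km: "K \<in> sets \<nu>" using measurable_sets[OF emb K'b] by (simp add: K_def sp)
  have "emeasure ?\<mu> K' = ennreal (measure \<nu> K)"
    using emeasure_distr[OF emb K'b] by (simp add: K_def sp emeasure_eq_measure)
  then have meas: "measure \<nu> A < measure \<nu> K + \<epsilon>" using K'(3) False by (simp add: ennreal_less_iff)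
  have KA: "K \<subseteq> A"
  proof
    fix \<omega> assume "\<omega> \<in> K"
    then have "?emb \<omega> \<in> ?B" using K'(1) unfolding K_def by blast
    then show "\<omega> \<in> A" by (simp only: vimage_eq de)
  qed
  have "seq_compact_cfgs K"
    unfolding seq_compact_cfgs_def
  proof (intro allI impI)
    fix k :: "nat \<Rightarrow> face \<Rightarrow> bool" assume "\<forall>n. k n \<in> K"
    then have "\<forall>n. ?emb (k n) \<in> K'" by (simp add: K_def)
    then obtain l r where l: "l \<in> K'" "strict_mono r" "(\<lambda>n. ?emb (k (r n))) \<longlonglongrightarrow> l"
      using K'(2) unfolding compact_eq_seq_compact_metric seq_compact_def o_def by meson
    have comp: "(\<lambda>n. of_bool (k (r n) f)) \<longlonglongrightarrow> l f" for f
    proof -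
      have "isCont (\<lambda>x :: face \<Rightarrow> real. x f) l"
        using continuous_on_product_coordinates[of f]
        by (rule continuous_on_interior) simp
      from isCont_tendsto_compose[OF this l(3)] show ?thesis by simp
    qed
    have ev: "\<forall>\<^sub>F n in sequentially. of_bool (k (r n) f) = l f" for f
    proof -
      \<comment> \<open>A limit of values 0 and 1 is again one of them, and two such values at
        distance below 1 coincide.\<close>
      have "l f \<in> {0, 1}"
        by (rule Lim_in_closed_set[OF _ _ _ comp[of f]]) (auto simp: of_bool_def)
      moreover have "\<forall>\<^sub>F n in sequentially. dist (of_bool (k (r n) f)) (l f) < 1"
        using tendstoD[OF comp[of f], of 1] by simp
      ultimately show ?thesis by (auto simp: of_bool_def dist_real_def elim!: eventually_mono)
    qed
    have l01: "?emb (?dec l) = l"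
    proof
      fix f
      obtain n where "of_bool (k (r n) f) = l f" using ev[of f] by (auto simp: eventually_sequentially)
      then show "?emb (?dec l) f = l f" by (cases "k (r n) f") auto
    qed
    have "\<forall>\<^sub>F n in sequentially. k (r n) f = ?dec l f" for f
      using ev[of f] by eventually_elim (metis de)
    moreover have "?dec l \<in> K" using l(1) l01 by (simp add: K_def)
    ultimately show "\<exists>l\<in>K. \<exists>r. strict_mono r \<and> (\<forall>f. \<forall>\<^sub>F n in sequentially. k (r n) f = l f)"
      using l(2) by (intro bexI[of _ "?dec l"] exI[of _ r]) auto
  qed
  with KA Km meas show thesis using that by blast
qed

text \<open>The smallest event containing \<open>X\<close> that is determined by the spins in the
  box.\<close>

definition cyl_hull :: "(face \<Rightarrow> bool) set \<Rightarrow> nat \<Rightarrow> (face \<Rightarrow> bool) set" where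
  "cyl_hull X n = {\<omega>. \<exists>\<omega>'\<in>X. \<forall>f\<in>box (int n). \<omega> f = \<omega>' f}"

lemma cylinder_cyl_hull: "cylinder_event (cyl_hull X n)"
  unfolding cylinder_event_def cyl_hull_def by (intro exI[of _ "box (int n)"]) simp

lemma subset_cyl_hull: "X \<subseteq> cyl_hull X n"
  by (auto simp: cyl_hull_def)

lemma decseq_cyl_hull: "decseq (cyl_hull X)"
proof (rule decseq_SucI)
  fix n
  have "box (int n) \<subseteq> box (int (Suc n))" by (auto simp: box_def)
  then show "cyl_hull X (Suc n) \<subseteq> cyl_hull X n" unfolding cyl_hull_def by blast
qed

lemma eventually_in_box: "\<forall>\<^sub>F n in sequentially. f \<in> box (int n)"
proof -
  obtain m where m: "{f} \<subseteq> box (int m)" by (rule finite_subset_box[of "{f}"]) auto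
  show ?thesis using eventually_ge_at_top[of m] by eventually_elim (use m in \<open>auto simp: box_def\<close>)
qed

text \<open>Compactness: a witness in \<open>K\<close> for each box has a subsequential limit in
  \<open>K\<close>, and the facewise relation passes to it. One statement serves both equality, for
  \<open>K\<close>, and the order, for its up-closure.\<close>

lemma INT_cyl_hull_relation:
  assumes K: "seq_compact_cfgs K" and R: "\<And>k \<omega>. R k \<omega> \<longleftrightarrow> (\<forall>f. Q (k f) (\<omega> f))"
  shows "(\<Inter>n. cyl_hull {\<omega>. \<exists>k\<in>K. R k \<omega>} n) = {\<omega>. \<exists>k\<in>K. R k \<omega>}"
proof (intro equalityI subsetI)
  fix \<omega> assume "\<omega> \<in> (\<Inter>n. cyl_hull {\<omega>. \<exists>k\<in>K. R k \<omega>} n)"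
  have "\<forall>n. \<exists>k. k \<in> K \<and> (\<forall>f\<in>box (int n). Q (k f) (\<omega> f))"
  proof
    fix n
    obtain \<tau> k where "k \<in> K" "R k \<tau>" "\<forall>f\<in>box (int n). \<omega> f = \<tau> f"
      using \<open>\<omega> \<in> _\<close> unfolding cyl_hull_def by blast
    then have "k \<in> K \<and> (\<forall>f\<in>box (int n). Q (k f) (\<omega> f))" by (simp add: R)
    then show "\<exists>k. k \<in> K \<and> (\<forall>f\<in>box (int n). Q (k f) (\<omega> f))" by blast
  qed
  then obtain k where k: "\<And>n. k n \<in> K" "\<And>n f. f \<in> box (int n) \<Longrightarrow> Q (k n f) (\<omega> f)" by metis
  then obtain l r where l: "l \<in> K" "strict_mono r" "\<And>f. \<forall>\<^sub>F n in sequentially. k (r n) f = l f"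
    using K unfolding seq_compact_cfgs_def by metis
  have "Q (l f) (\<omega> f)" for f
  proof -
    \<comment> \<open>The boxes still exhaust all faces along the subsequence.\<close>
    have "\<forall>\<^sub>F n in sequentially. f \<in> box (int (r n))"
      using eventually_in_box filterlim_subseq[OF l(2)] unfolding filterlim_iff by blast
    with l(3)[of f] have "\<forall>\<^sub>F n in sequentially. Q (l f) (\<omega> f)"
    proof eventually_elim
      case (elim n)
      then show ?case using k(2)[OF elim(2)] by simp
    qed
    then show ?thesis by simp
  qed
  then show "\<omega> \<in> {\<omega>. \<exists>k\<in>K. R k \<omega>}" using l(1) R by blast
next
  fix \<omega> assume "\<omega> \<in> {\<omega>. \<exists>k\<in>K. R k \<omega>}"
  then show "\<omega> \<in> (\<Inter>n. cyl_hull {\<omega>. \<exists>k\<in>K. R k \<omega>} n)"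
    by (intro INT_I subsetD[OF subset_cyl_hull])
qed

text \<open>Replaces a compact subset of an increasing event by a larger subset of that event which
  is itself increasing, so that its cylinder hulls are accessible to FKG.\<close>

definition up_closure :: "(face \<Rightarrow> bool) set \<Rightarrow> (face \<Rightarrow> bool) set" where
  "up_closure K = {\<omega>. \<exists>k\<in>K. k \<le> \<omega>}"

lemma INT_cyl_hull:
  assumes "seq_compact_cfgs K"
  shows "(\<Inter>n. cyl_hull K n) = K" "(\<Inter>n. cyl_hull (up_closure K) n) = up_closure K"
proof -
  have "{\<omega>. \<exists>k\<in>K. k = \<omega>} = K" by auto
  with INT_cyl_hull_relation[of K "(=)" "(=)", OF assms fun_eq_iff] show "(\<Inter>n. cyl_hull K n) = K"
    by simp
  show "(\<Inter>n. cyl_hull (up_closure K) n) = up_closure K"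
    unfolding up_closure_def by (rule INT_cyl_hull_relation[OF assms]) (simp add: le_fun_def)
qed

lemma increasing_cyl_hull_up_closure: "increasing_event (cyl_hull (up_closure K) n)"
  unfolding increasing_event_def
proof (intro allI impI)
  fix \<omega> \<omega>' :: "face \<Rightarrow> bool" assume "\<omega> \<in> cyl_hull (up_closure K) n" and le: "\<omega> \<le> \<omega>'"
  then obtain k \<tau> where k: "k \<in> K" "k \<le> \<tau>" "\<forall>f\<in>box (int n). \<omega> f = \<tau> f"
    by (auto simp: cyl_hull_def up_closure_def)
  \<comment> \<open>Equal to \<open>\<omega>'\<close> in the box and plus outside, hence above
    \<open>k\<close> everywhere.\<close>
  let ?\<tau> = "\<lambda>f. f \<in> box (int n) \<longrightarrow> \<omega>' f"
  have "k \<le> ?\<tau>" using k le by (auto simp: le_fun_def)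
  then have "?\<tau> \<in> up_closure K" using k(1) by (auto simp: up_closure_def)
  then show "\<omega>' \<in> cyl_hull (up_closure K) n" unfolding cyl_hull_def by (auto intro!: bexI[of _ ?\<tau>])
qed

section \<open>Translation invariance, ergodicity and positive association\<close>

context
  fixes \<nu> :: "(face \<Rightarrow> bool) measure"
  assumes prob: "prob_space \<nu>" and sets: "sets \<nu> = sets cfg_space"
    and cyl: "\<And>A. cylinder_event A \<Longrightarrow> measure \<nu> A = lv A"
begin

interpretation prob_space \<nu> by (rule prob)

lemma space_UNIV: "space \<nu> = UNIV"
  using sets_eq_imp_space_eq[OF sets] by simp

lemma cylinder_sets: "cylinder_event A \<Longrightarrow> A \<in> sets \<nu>"
  using cylinder_measurable sets by simp

lemma shift_measurable: "shift_cfg v \<in> measurable \<nu> \<nu>"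
proof -
  have "shift_cfg v \<in> measurable cfg_space cfg_space"
    unfolding cfg_space_def
  proof (rule measurable_PiM_single')
    fix f :: face
    have "(\<lambda>\<omega>. shift_cfg v \<omega> f) = (\<lambda>\<omega>. \<omega> (translate v f))" by (simp add: shift_cfg_translate)
    then show "(\<lambda>\<omega>. shift_cfg v \<omega> f) \<in> measurable (PiM UNIV (\<lambda>_. count_space UNIV)) (count_space UNIV)"
      by (simp add: measurable_component_singleton)
  qed (auto simp: space_PiM)
  then show ?thesis by (simp add: measurable_cong_sets[OF sets sets])
qed

lemma translation_invariant: "distr \<nu> \<nu> (shift_cfg v) = \<nu>"
proof (rule measure_eqI_PiM_infinite[where I = UNIV and M = "\<lambda>_. count_space UNIV"])
  fix A :: "face \<Rightarrow> bool set" and J :: "face set"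
  assume J: "finite J"
  let ?X = "prod_emb UNIV (\<lambda>_. count_space UNIV) J (Pi\<^sub>E J A)"
  have "cylinder_event ?X"
    unfolding cylinder_event_def using J by (intro exI[of _ J]) (auto simp: prod_emb_def PiE_iff)
  moreover have "emeasure (distr \<nu> \<nu> (shift_cfg v)) ?X = emeasure \<nu> (shift_cfg v -` ?X)"
    using cylinder_sets[OF \<open>cylinder_event ?X\<close>] by (simp add: emeasure_distr[OF shift_measurable] space_UNIV)
  ultimately show "emeasure (distr \<nu> \<nu> (shift_cfg v)) ?X = emeasure \<nu> ?X"
    by (simp add: emeasure_eq_measure cyl cylinder_shift lv_shift)
qed (use sets in \<open>simp_all add: cfg_space_def finite_measure.intro prob_space.finite_measure prob_space_distr shift_measurable\<close>)

lemma measure_shift: "A \<in> sets \<nu> \<Longrightarrow> measure \<nu> (shift_cfg v -` A) = measure \<nu> A"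
  using measure_distr[OF shift_measurable, of A v] by (simp add: translation_invariant space_UNIV)

text \<open>Expanding both copies of the indicator reduces the claim, bilinearly, to
  \<open>lv_all_plus_mixing\<close> for pairs of all-plus events.\<close>

lemma cylinder_mixing:
  assumes C: "cylinder_event C"
  shows "(\<lambda>n. measure \<nu> (C \<inter> shift_cfg (int n, 0) -` C)) \<longlonglongrightarrow> (measure \<nu> C)\<^sup>2"
proof -
  obtain S c where S: "finite S" and c: "\<And>\<omega>. indicat_real C \<omega> = (\<Sum>U\<in>Pow S. c U * indicat_real (all_plus U) \<omega>)"
    using cylinder_expansion[OF C] by blast
  have fin: "finite U" if "U \<in> Pow S" for U using that S finite_subset by blast
  let ?t = "\<lambda>n. translate (int n, 0)" and ?K = "Pow S \<times> Pow S"
  have ind: "indicat_real (C \<inter> shift_cfg (int n, 0) -` C) \<omega> =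
    (\<Sum>p\<in>?K. (c (fst p) * c (snd p)) * indicat_real (all_plus (fst p \<union> ?t n ` snd p)) \<omega>)" for n \<omega>
  proof -
    have "indicat_real (C \<inter> shift_cfg (int n, 0) -` C) \<omega> = indicat_real C \<omega> * indicat_real C (shift_cfg (int n, 0) \<omega>)"
      by (simp add: indicator_def)
    also have "\<dots> = (\<Sum>p\<in>?K. (c (fst p) * indicat_real (all_plus (fst p)) \<omega>) *
        (c (snd p) * indicat_real (all_plus (snd p)) (shift_cfg (int n, 0) \<omega>)))"
      unfolding c by (simp only: sum_product sum.cartesian_product case_prod_unfold)
    also have "\<dots> = (\<Sum>p\<in>?K. (c (fst p) * c (snd p)) * indicat_real (all_plus (fst p \<union> ?t n ` snd p)) \<omega>)"
      by (rule sum.cong) (simp_all add: indicator_def all_plus_Un flip: shift_vimage_all_plus)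
    finally show ?thesis .
  qed
  have meas: "C \<inter> shift_cfg (int n, 0) -` C \<in> sets cfg_space" for n
    by (intro cylinder_measurable cylinder_Int cylinder_shift C)
  have eq: "measure \<nu> (C \<inter> shift_cfg (int n, 0) -` C) =
    (\<Sum>p\<in>?K. (c (fst p) * c (snd p)) * lv (all_plus (fst p \<union> ?t n ` snd p)))" for n
  proof -
    have f: "finite (fst p \<union> ?t n ` snd p)" if "p \<in> ?K" for p using that fin by auto
    show ?thesis
      using measure_expansion[OF prob sets _ f meas ind] S f by (simp add: cyl cylinder_all_plus)
  qed
  have "(\<lambda>n. \<Sum>p\<in>?K. (c (fst p) * c (snd p)) * lv (all_plus (fst p \<union> ?t n ` snd p)))
    \<longlonglongrightarrow> (\<Sum>p\<in>?K. (c (fst p) * c (snd p)) * (lv (all_plus (fst p)) * lv (all_plus (snd p))))"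
    using fin by (intro tendsto_sum tendsto_mult_left lv_all_plus_mixing) auto
  also have "(\<Sum>p\<in>?K. (c (fst p) * c (snd p)) * (lv (all_plus (fst p)) * lv (all_plus (snd p))))
    = (\<Sum>U\<in>Pow S. c U * lv (all_plus U)) * (\<Sum>U\<in>Pow S. c U * lv (all_plus U))"
    by (simp add: sum_product sum.cartesian_product case_prod_unfold mult_ac)
  also have "(\<Sum>U\<in>Pow S. c U * lv (all_plus U)) = measure \<nu> C"
    using measure_expansion[OF prob sets _ _ cylinder_measurable[OF C] c] S fin by (simp add: cyl cylinder_all_plus)
  finally show ?thesis by (simp add: eq power2_eq_square)
qed

lemma measure_cyl_hull_tendsto:
  "(\<Inter>n. cyl_hull X n) = X \<Longrightarrow> (\<lambda>n. measure \<nu> (cyl_hull X n)) \<longlonglongrightarrow> measure \<nu> X"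
  using finite_Lim_measure_decseq[OF _ decseq_cyl_hull, of X] cylinder_sets[OF cylinder_cyl_hull] by auto

text \<open>A cylinder approximation \<open>?C\<close> of an invariant event meets its own
  translates in probability almost \<open>?a\<close>, while mixing sends that probability to the
  square of the probability of \<open>?C\<close>. This forces
  \<open>?a \<le> ?a * ?a\<close>.\<close>

lemma ergodic:
  assumes A: "A \<in> sets \<nu>" and inv: "\<And>v. shift_cfg v -` A = A"
  shows "measure \<nu> A = 0 \<or> measure \<nu> A = 1"
proof -
  let ?a = "measure \<nu> A"
  have approx: "?a - 2 * \<epsilon> \<le> (?a + \<epsilon>)\<^sup>2" if \<epsilon>: "\<epsilon> > 0" for \<epsilon>
  proof -
    obtain K where K: "K \<subseteq> A" "K \<in> sets \<nu>" "seq_compact_cfgs K" "?a < measure \<nu> K + \<epsilon>"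
      using inner_seq_compact[OF prob sets A \<epsilon>] by blast
    have "\<forall>\<^sub>F n in sequentially. measure \<nu> (cyl_hull K n) < measure \<nu> K + \<epsilon>"
      using measure_cyl_hull_tendsto[OF INT_cyl_hull(1)[OF K(3)]] \<epsilon> by (intro order_tendstoD) auto
    then obtain m where m: "measure \<nu> (cyl_hull K m) < measure \<nu> K + \<epsilon>" by (auto simp: eventually_sequentially)
    let ?C = "cyl_hull K m"
    \<comment> \<open>By invariance, a point of \<open>A\<close> outside \<open>?C\<close> or
      outside its preimage lies in \<open>A - K\<close> or in the preimage of \<open>A - K\<close>.
      Each has probability at most \<epsilon>, uniformly in the shift.\<close>
    have lower: "?a - 2 * \<epsilon> \<le> measure \<nu> (?C \<inter> shift_cfg v -` ?C)" for v
    proof -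
      have AK: "measure \<nu> (A - K) \<le> \<epsilon>" using finite_measure_Diff[OF A K(2,1)] K(4) by simp
      have "measure \<nu> (shift_cfg v -` (A - K)) = measure \<nu> (A - K)" using A K by (intro measure_shift) auto
      moreover have sh: "shift_cfg v -` (A - K) \<in> sets \<nu>"
        using measurable_sets[OF shift_measurable, of "A - K" v] A K by (auto simp: space_UNIV)
      ultimately have small: "measure \<nu> ((A - K) \<union> shift_cfg v -` (A - K)) \<le> 2 * \<epsilon>"
        using measure_Un_le[OF sets.Diff[OF A K(2)] sh] AK by linarith
      have CC: "?C \<inter> shift_cfg v -` ?C \<in> sets \<nu>"
        by (intro cylinder_sets cylinder_Int cylinder_shift cylinder_cyl_hull)
      have "A \<subseteq> (?C \<inter> shift_cfg v -` ?C) \<union> ((A - K) \<union> shift_cfg v -` (A - K))"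
        using inv[of v] subset_cyl_hull[of K m] by blast
      then have "?a \<le> measure \<nu> ((?C \<inter> shift_cfg v -` ?C) \<union> ((A - K) \<union> shift_cfg v -` (A - K)))"
        using A K CC sh by (intro finite_measure_mono) auto
      also have "\<dots> \<le> measure \<nu> (?C \<inter> shift_cfg v -` ?C) + measure \<nu> ((A - K) \<union> shift_cfg v -` (A - K))"
        using A K CC sh by (intro measure_Un_le) auto
      finally show ?thesis using small by linarith
    qed
    have "?a - 2 * \<epsilon> \<le> (measure \<nu> ?C)\<^sup>2"
      by (rule tendsto_lowerbound[OF cylinder_mixing[OF cylinder_cyl_hull]]) (use lower in auto)
    also have "measure \<nu> ?C \<le> ?a + \<epsilon>" using m finite_measure_mono[OF K(1) A] by linarith
    then have "(measure \<nu> ?C)\<^sup>2 \<le> (?a + \<epsilon>)\<^sup>2" by (intro power_mono) auto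
    finally show ?thesis .
  qed
  \<comment> \<open>The limit of \<open>approx\<close> as \<epsilon> decreases to 0.\<close>
  have "?a - 2 * 0 \<le> (?a + 0)\<^sup>2"
  proof (rule tendsto_le[OF trivial_limit_at_right_real])
    show "((\<lambda>\<epsilon>. (?a + \<epsilon>)\<^sup>2) \<longlongrightarrow> (?a + 0)\<^sup>2) (at_right 0)" by (intro tendsto_intros)
    show "((\<lambda>\<epsilon>. ?a - 2 * \<epsilon>) \<longlongrightarrow> ?a - 2 * 0) (at_right 0)" by (intro tendsto_intros)
    show "\<forall>\<^sub>F \<epsilon> in at_right 0. ?a - 2 * \<epsilon> \<le> (?a + \<epsilon>)\<^sup>2"
      using eventually_at_right_less[of 0] by eventually_elim (rule approx)
  qed
  then have "?a * (1 - ?a) \<le> 0" by (simp add: power2_eq_square algebra_simps)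
  then show ?thesis using prob_le_1[of A] measure_nonneg[of \<nu> A] by (auto simp: mult_le_0_iff)
qed

lemma positively_associated:
  assumes A: "A \<in> sets \<nu>" "increasing_event A" and B: "B \<in> sets \<nu>" "increasing_event B"
  shows "measure \<nu> A * measure \<nu> B \<le> measure \<nu> (A \<inter> B)"
proof -
  \<comment> \<open>\<open>up_closure K\<close> is measurable because it is the countable
    intersection of its cylinder hulls.\<close>
  have up: "\<exists>X. X \<subseteq> D \<and> X \<in> sets \<nu> \<and> measure \<nu> D \<le> measure \<nu> X + \<epsilon> \<and>
      (\<Inter>n. cyl_hull X n) = X \<and> (\<forall>n. increasing_event (cyl_hull X n))"
    if D: "D \<in> sets \<nu>" "increasing_event D" and \<epsilon>: "\<epsilon> > 0" for D \<epsilon>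
  proof -
    obtain K where K: "K \<subseteq> D" "K \<in> sets \<nu>" "seq_compact_cfgs K" "measure \<nu> D < measure \<nu> K + \<epsilon>"
      using inner_seq_compact[OF prob sets D(1) \<epsilon>] by blast
    note hull = INT_cyl_hull(2)[OF K(3)]
    have "(\<Inter>n. cyl_hull (up_closure K) n) \<in> sets \<nu>"
      using sets.top[of \<nu>] unfolding space_UNIV
      by (rule sets.countable_INT'') (simp_all add: cylinder_sets cylinder_cyl_hull)
    then have m: "up_closure K \<in> sets \<nu>" by (simp only: hull)
    have "up_closure K \<subseteq> D" using K(1) D(2) unfolding up_closure_def increasing_event_def by blast
    moreover have "measure \<nu> K \<le> measure \<nu> (up_closure K)"
      by (rule finite_measure_mono[OF _ m]) (auto simp: up_closure_def)
    ultimately show ?thesis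
      using m hull K(4) increasing_cyl_hull_up_closure by (intro exI[of _ "up_closure K"]) auto
  qed
  show ?thesis
  proof (rule field_le_epsilon)
    fix e :: real assume "e > 0"
    then have e2: "e / 2 > 0" by simp
    obtain X where X: "X \<subseteq> A" "X \<in> sets \<nu>" "measure \<nu> A \<le> measure \<nu> X + e / 2"
      "(\<Inter>n. cyl_hull X n) = X" "\<And>n. increasing_event (cyl_hull X n)" using up[OF A e2] by blast
    obtain Y where Y: "Y \<subseteq> B" "Y \<in> sets \<nu>" "measure \<nu> B \<le> measure \<nu> Y + e / 2"
      "(\<Inter>n. cyl_hull Y n) = Y" "\<And>n. increasing_event (cyl_hull Y n)" using up[OF B e2] by blast
    \<comment> \<open>FKG holds for the increasing cylinder hulls, and all three probabilities
      converge as the hulls decrease.\<close>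
    have "measure \<nu> X * measure \<nu> Y \<le> measure \<nu> (X \<inter> Y)"
    proof (rule LIMSEQ_le)
      show "(\<lambda>n. measure \<nu> (cyl_hull X n) * measure \<nu> (cyl_hull Y n)) \<longlonglongrightarrow> measure \<nu> X * measure \<nu> Y"
        by (intro tendsto_mult measure_cyl_hull_tendsto X Y)
      have dec: "decseq (\<lambda>n. cyl_hull X n \<inter> cyl_hull Y n)"
        using decseq_cyl_hull[of X] decseq_cyl_hull[of Y] unfolding decseq_def by blast
      have eq: "(\<Inter>n. cyl_hull X n \<inter> cyl_hull Y n) = X \<inter> Y" using X(4) Y(4) by blast
      have "range (\<lambda>n. cyl_hull X n \<inter> cyl_hull Y n) \<subseteq> sets \<nu>"
        using cylinder_sets[OF cylinder_cyl_hull] by auto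
      from finite_Lim_measure_decseq[OF this dec] show "(\<lambda>n. measure \<nu> (cyl_hull X n \<inter> cyl_hull Y n)) \<longlonglongrightarrow> measure \<nu> (X \<inter> Y)"
        unfolding eq .
      show "\<exists>N. \<forall>n\<ge>N. measure \<nu> (cyl_hull X n) * measure \<nu> (cyl_hull Y n) \<le> measure \<nu> (cyl_hull X n \<inter> cyl_hull Y n)"
        using lv_FKG[OF cylinder_cyl_hull cylinder_cyl_hull X(5) Y(5)]
        by (simp add: cyl cylinder_cyl_hull cylinder_Int)
    qed
    also have "\<dots> \<le> measure \<nu> (A \<inter> B)" using X Y A B by (intro finite_measure_mono) auto
    finally have "measure \<nu> X * measure \<nu> Y \<le> measure \<nu> (A \<inter> B)" .
    moreover have "measure \<nu> A * measure \<nu> B \<le> measure \<nu> X * measure \<nu> Y + e"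
    proof -
      \<comment> \<open>Replacing one factor at a time, each replacement costs at most
        \<open>e / 2\<close>, since the other factor is a probability.\<close>
      have "measure \<nu> A * measure \<nu> B - measure \<nu> X * measure \<nu> Y =
        measure \<nu> A * (measure \<nu> B - measure \<nu> Y) + measure \<nu> Y * (measure \<nu> A - measure \<nu> X)"
        by (simp add: algebra_simps)
      also have "\<dots> \<le> 1 * (e / 2) + 1 * (e / 2)"
        using X Y A B \<open>e > 0\<close> finite_measure_mono[OF X(1) A(1)] finite_measure_mono[OF Y(1) B(1)]
        by (intro add_mono mult_mono) auto
      finally show ?thesis by simp
    qed
    ultimately show "measure \<nu> A * measure \<nu> B \<le> measure \<nu> (A \<inter> B) + e" by linarith
  qed
qed

end

theorem theorem3p4:
  shows "\<exists>\<nu> :: (face \<Rightarrow> bool) measure.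
    prob_space \<nu> \<and> sets \<nu> = sets cfg_space \<and>
    (\<forall>P :: nat \<Rightarrow> hedge set.
        (\<forall>n. is_sap (P n)) \<longrightarrow>
        (\<forall>n. dom_edges (P n) \<subseteq> dom_edges (P (Suc n))) \<longrightarrow>
        (\<Union>n. dom_edges (P n)) = hex_edges \<longrightarrow>
        (\<forall>A. cylinder_event A \<longrightarrow>
           (\<lambda>n. nu_plus_free (P n) A) \<longlonglongrightarrow> measure \<nu> A)) \<and>
    (\<forall>v. distr \<nu> \<nu> (shift_cfg v) = \<nu>) \<and>
    (\<forall>A \<in> sets \<nu>. (\<forall>v. shift_cfg v -` A = A) \<longrightarrow> measure \<nu> A = 0 \<or> measure \<nu> A = 1) \<and>
    (\<forall>A B. A \<in> sets \<nu> \<longrightarrow> B \<in> sets \<nu> \<longrightarrow> increasing_event A \<longrightarrow> increasing_event B \<longrightarrow>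
        measure \<nu> (A \<inter> B) \<ge> measure \<nu> A * measure \<nu> B)"
proof -
  obtain \<nu> where \<nu>: "prob_space \<nu>" "sets \<nu> = sets cfg_space" "\<And>A. cylinder_event A \<Longrightarrow> measure \<nu> A = lv A"
    using infinite_volume_measure_exists by blast
  have conv: "(\<lambda>n. nu_plus_free (P n) A) \<longlonglongrightarrow> measure \<nu> A"
    if "\<forall>n. is_sap (P n)" "\<forall>n. dom_edges (P n) \<subseteq> dom_edges (P (Suc n))" "(\<Union>n. dom_edges (P n)) = hex_edges"
      "cylinder_event A" for P :: "nat \<Rightarrow> hedge set" and A
    using filterlim_compose[OF fv_tendsto[OF that(4)] filterlim_interior_faces[of P]] that
    by (simp add: nu_plus_free_eq_fv \<nu>(3))
  show ?thesis
  proof (intro exI[of _ \<nu>] conjI allI ballI impI)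
    fix A assume "A \<in> sets \<nu>" "\<forall>v. shift_cfg v -` A = A"
    then show "measure \<nu> A = 0 \<or> measure \<nu> A = 1" using ergodic[OF \<nu>] by simp
  qed (use \<nu>(1,2) conv translation_invariant[OF \<nu>] positively_associated[OF \<nu>] in simp_all)
qed

end
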